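(* Let $\mathbb{M}$ be a monster model of a complete $C$-minimal expansion of ACVF whose language contains a constant symbol $t$ with $v(t)>0$. Let $B\subseteq\mathbb{M}$ be a ball containing $0$, let $U\subseteq\mathbb{M}^k$ be definable and open, and let $f:U\times B\to\mathbb{M}$ be a definable function such that $\lim_{y\to0}f(a,y)=f(a,0)$ for every $a\in U$. Then $\dim\{a\in U: f\text{ is discontinuous at }(a,0)\}<k$.
   Context: ACVF is the theory of algebraically closed non-trivially valued fields; $C$-minimal means every definable subset of the home sort is a finite boolean combination of balls and points. "Definable" means with parameters; $\mathbb{M}^k$ carries the product valuation topology. $\dim$ of a definable set is its dp-rank (equivalently acl-dimension). *)

theory Defs
  imports "HOL-Analysis.Analysis" "HOL-Library.Extended"
begin

unbundle cardinal_syntax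

section \<open>One-sorted first-order structures\<close>

datatype 'f fo_term = Var nat | App 'f "'f fo_term list"

datatype ('f, 'r) fo_formula =
    Eq "'f fo_term" "'f fo_term"
  | Rel 'r "'f fo_term list"
  | Neg "('f, 'r) fo_formula"
  | Conj "('f, 'r) fo_formula" "('f, 'r) fo_formula"
  | Exi nat "('f, 'r) fo_formula"

text \<open>
  The language consists of all elements of the types \<open>'f\<close> and \<open>'r\<close>, with the given arities;
  constant symbols are function symbols of arity 0. The universe of the structure is the whole
  type \<open>'a\<close>. Interpretations are only meaningful on argument lists of the right length.
\<close>

record ('f, 'r, 'a) fo_structure =
  fun_arity :: "'f \<Rightarrow> nat"
  rel_arity :: "'r \<Rightarrow> nat"
  fun_int :: "'f \<Rightarrow> 'a list \<Rightarrow> 'a"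
  rel_int :: "'r \<Rightarrow> 'a list \<Rightarrow> bool"

primrec fv_term :: "'f fo_term \<Rightarrow> nat set" where
  "fv_term (Var i) = {i}"
| "fv_term (App s ts) = \<Union> (set (map fv_term ts))"

primrec fv :: "('f, 'r) fo_formula \<Rightarrow> nat set" where
  "fv (Eq t u) = fv_term t \<union> fv_term u"
| "fv (Rel r ts) = \<Union> (fv_term ` set ts)"
| "fv (Neg \<phi>) = fv \<phi>"
| "fv (Conj \<phi> \<psi>) = fv \<phi> \<union> fv \<psi>"
| "fv (Exi i \<phi>) = fv \<phi> - {i}"

primrec wf_term :: "('f, 'r, 'a) fo_structure \<Rightarrow> 'f fo_term \<Rightarrow> bool" where
  "wf_term M (Var i) \<longleftrightarrow> True"
| "wf_term M (App s ts) \<longleftrightarrow> length ts = fun_arity M s \<and> list_all id (map (wf_term M) ts)"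

primrec wf_formula :: "('f, 'r, 'a) fo_structure \<Rightarrow> ('f, 'r) fo_formula \<Rightarrow> bool" where
  "wf_formula M (Eq t u) \<longleftrightarrow> wf_term M t \<and> wf_term M u"
| "wf_formula M (Rel r ts) \<longleftrightarrow> length ts = rel_arity M r \<and> list_all (wf_term M) ts"
| "wf_formula M (Neg \<phi>) \<longleftrightarrow> wf_formula M \<phi>"
| "wf_formula M (Conj \<phi> \<psi>) \<longleftrightarrow> wf_formula M \<phi> \<and> wf_formula M \<psi>"
| "wf_formula M (Exi i \<phi>) \<longleftrightarrow> wf_formula M \<phi>"

primrec eval_term :: "('f, 'r, 'a) fo_structure \<Rightarrow> (nat \<Rightarrow> 'a) \<Rightarrow> 'f fo_term \<Rightarrow> 'a" where
  "eval_term M e (Var i) = e i"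
| "eval_term M e (App s ts) = fun_int M s (map (eval_term M e) ts)"

primrec sat :: "('f, 'r, 'a) fo_structure \<Rightarrow> (nat \<Rightarrow> 'a) \<Rightarrow> ('f, 'r) fo_formula \<Rightarrow> bool" where
  "sat M e (Eq t u) \<longleftrightarrow> eval_term M e t = eval_term M e u"
| "sat M e (Rel r ts) \<longleftrightarrow> rel_int M r (map (eval_term M e) ts)"
| "sat M e (Neg \<phi>) \<longleftrightarrow> \<not> sat M e \<phi>"
| "sat M e (Conj \<phi> \<psi>) \<longleftrightarrow> sat M e \<phi> \<and> sat M e \<psi>"
| "sat M e (Exi i \<phi>) \<longleftrightarrow> (\<exists>x. sat M (e(i := x)) \<phi>)"

section \<open>Definable sets\<close>

text \<open>
  The power \<open>M\<^sup>n\<close> is the set of extensional functions on \<open>{..<n}\<close>, as for the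
  library's product topology. In a formula about \<open>n\<close>-tuples the variables \<open>0, \<dots>, n - 1\<close> stand
  for the tuple and all other free variables for parameters.
\<close>

abbreviation tuples :: "nat \<Rightarrow> (nat \<Rightarrow> 'a) set" where
  "tuples n \<equiv> {..<n} \<rightarrow>\<^sub>E UNIV"

definition tuple_env :: "nat \<Rightarrow> (nat \<Rightarrow> 'a) \<Rightarrow> (nat \<Rightarrow> 'a) \<Rightarrow> nat \<Rightarrow> 'a" where
  "tuple_env n a p = (\<lambda>i. if i < n then a i else p i)"

definition definable :: "('f, 'r, 'a) fo_structure \<Rightarrow> nat \<Rightarrow> (nat \<Rightarrow> 'a) set \<Rightarrow> bool" where
  "definable M n X \<longleftrightarrow>
     (\<exists>\<phi> p. wf_formula M \<phi> \<and> X = {a \<in> tuples n. sat M (tuple_env n a p) \<phi>})"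

text \<open>Definability of \<open>f : U \<times> B \<rightarrow> M\<close>, where \<open>U \<subseteq> M\<^sup>k\<close> and \<open>B \<subseteq> M\<close>, via its graph
  in \<open>M\<^bsup>k+2\<^esup>\<close>.\<close>

definition definable_fun ::
  "('f, 'r, 'a) fo_structure \<Rightarrow> nat \<Rightarrow> (nat \<Rightarrow> 'a) set \<Rightarrow> 'a set \<Rightarrow> ((nat \<Rightarrow> 'a) \<times> 'a \<Rightarrow> 'a) \<Rightarrow> bool"
  where
  "definable_fun M k U B f \<longleftrightarrow>
     definable M (k + 2)
       {e \<in> tuples (k + 2). restrict e {..<k} \<in> U \<and> e k \<in> B \<and>
                             e (k + 1) = f (restrict e {..<k}, e k)}"

section \<open>Monster models\<close>

text \<open>A set of pairs \<open>(\<phi>, p)\<close> is a set of formulas with parameters, \<open>p\<close> assigning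
  the parameters to the free variables \<open>\<ge> n\<close>.\<close>

definition saturated :: "'c rel \<Rightarrow> ('f, 'r, 'a) fo_structure \<Rightarrow> bool" where
  "saturated \<kappa> M \<longleftrightarrow>
     (\<forall>(A :: 'a set) n (\<Sigma> :: (('f, 'r) fo_formula \<times> (nat \<Rightarrow> 'a)) set).
        |A| <o \<kappa> \<longrightarrow>
        (\<forall>(\<phi>, p) \<in> \<Sigma>. wf_formula M \<phi> \<and> (\<forall>i \<in> fv \<phi>. i < n \<or> p i \<in> A)) \<longrightarrow>
        (\<forall>F \<subseteq> \<Sigma>. finite F \<longrightarrow> (\<exists>a \<in> tuples n. \<forall>(\<phi>, p) \<in> F. sat M (tuple_env n a p) \<phi>)) \<longrightarrow>
        (\<exists>a \<in> tuples n. \<forall>(\<phi>, p) \<in> \<Sigma>. sat M (tuple_env n a p) \<phi>))"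

definition partial_elementary ::
  "('f, 'r, 'a) fo_structure \<Rightarrow> 'a set \<Rightarrow> ('a \<Rightarrow> 'a) \<Rightarrow> bool" where
  "partial_elementary M A g \<longleftrightarrow>
     (\<forall>\<phi> e. wf_formula M \<phi> \<longrightarrow> e ` fv \<phi> \<subseteq> A \<longrightarrow> (sat M e \<phi> \<longleftrightarrow> sat M (g \<circ> e) \<phi>))"

definition automorphism :: "('f, 'r, 'a) fo_structure \<Rightarrow> ('a \<Rightarrow> 'a) \<Rightarrow> bool" where
  "automorphism M \<sigma> \<longleftrightarrow> bij \<sigma> \<and>
     (\<forall>s xs. length xs = fun_arity M s \<longrightarrow> \<sigma> (fun_int M s xs) = fun_int M s (map \<sigma> xs)) \<and>
     (\<forall>r xs. length xs = rel_arity M r \<longrightarrow> (rel_int M r xs \<longleftrightarrow> rel_int M r (map \<sigma> xs)))"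

definition strongly_homogeneous :: "'c rel \<Rightarrow> ('f, 'r, 'a) fo_structure \<Rightarrow> bool" where
  "strongly_homogeneous \<kappa> M \<longleftrightarrow>
     (\<forall>A g. |A| <o \<kappa> \<longrightarrow> partial_elementary M A g \<longrightarrow>
        (\<exists>\<sigma>. automorphism M \<sigma> \<and> (\<forall>x \<in> A. \<sigma> x = g x)))"

definition monster_model :: "'c rel \<Rightarrow> ('f, 'r, 'a) fo_structure \<Rightarrow> bool" where
  "monster_model \<kappa> M \<longleftrightarrow>
     Card_order \<kappa> \<and> natLeq <o \<kappa> \<and> |UNIV :: 'f set| <o \<kappa> \<and> |UNIV :: 'r set| <o \<kappa> \<and>
     saturated \<kappa> M \<and> strongly_homogeneous \<kappa> M"

section \<open>Expansions of ACVF\<close>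

text \<open>Surjectivity makes \<open>'g\<close> the value group, so that it can serve as the set of radii of
  balls.\<close>

definition valuation :: "('a::field \<Rightarrow> 'g::linordered_ab_group_add extended) \<Rightarrow> bool" where
  "valuation v \<longleftrightarrow>
     range v = insert Pinf (range Fin) \<and>
     (\<forall>x. v x = Pinf \<longleftrightarrow> x = 0) \<and>
     (\<forall>x y. v (x * y) = v x + v y) \<and>
     (\<forall>x y. min (v x) (v y) \<le> v (x + y))"

definition has_fun_symbol ::
  "('f, 'r, 'a) fo_structure \<Rightarrow> nat \<Rightarrow> ('a list \<Rightarrow> 'a) \<Rightarrow> bool" where
  "has_fun_symbol M n h \<longleftrightarrow>
     (\<exists>s. fun_arity M s = n \<and> (\<forall>xs. length xs = n \<longrightarrow> fun_int M s xs = h xs))"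

definition has_rel_symbol ::
  "('f, 'r, 'a) fo_structure \<Rightarrow> nat \<Rightarrow> ('a list \<Rightarrow> bool) \<Rightarrow> bool" where
  "has_rel_symbol M n h \<longleftrightarrow>
     (\<exists>r. rel_arity M r = n \<and> (\<forall>xs. length xs = n \<longrightarrow> (rel_int M r xs \<longleftrightarrow> h xs)))"

text \<open>The valuation enters the one-sorted language through the relation \<open>v(x) \<le> v(y)\<close>.\<close>

definition ACVF_expansion ::
  "('f, 'r, 'a::alg_closed_field) fo_structure \<Rightarrow> ('a \<Rightarrow> 'g::linordered_ab_group_add extended) \<Rightarrow> bool"
  where
  "ACVF_expansion M v \<longleftrightarrow>
     valuation v \<and> (\<exists>x. x \<noteq> 0 \<and> v x \<noteq> 0) \<and>
     has_fun_symbol M 0 (\<lambda>xs. 0) \<and>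
     has_fun_symbol M 0 (\<lambda>xs. 1) \<and>
     has_fun_symbol M 1 (\<lambda>xs. - (xs ! 0)) \<and>
     has_fun_symbol M 2 (\<lambda>xs. xs ! 0 + xs ! 1) \<and>
     has_fun_symbol M 2 (\<lambda>xs. xs ! 0 * xs ! 1) \<and>
     has_rel_symbol M 2 (\<lambda>xs. v (xs ! 0) \<le> v (xs ! 1))"

definition open_ball :: "('a::field \<Rightarrow> 'g::linordered_ab_group_add extended) \<Rightarrow> 'a \<Rightarrow> 'g \<Rightarrow> 'a set"
  where "open_ball v c \<gamma> = {x. Fin \<gamma> < v (x - c)}"

definition closed_ball :: "('a::field \<Rightarrow> 'g::linordered_ab_group_add extended) \<Rightarrow> 'a \<Rightarrow> 'g \<Rightarrow> 'a set"
  where "closed_ball v c \<gamma> = {x. Fin \<gamma> \<le> v (x - c)}"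

definition is_ball :: "('a::field \<Rightarrow> 'g::linordered_ab_group_add extended) \<Rightarrow> 'a set \<Rightarrow> bool" where
  "is_ball v B \<longleftrightarrow> (\<exists>c \<gamma>. B = open_ball v c \<gamma> \<or> B = closed_ball v c \<gamma>)"

inductive boolean_combination :: "'a set set \<Rightarrow> 'a set \<Rightarrow> bool" for \<B> where
  base: "X \<in> \<B> \<Longrightarrow> boolean_combination \<B> X"
| empty: "boolean_combination \<B> {}"
| compl: "boolean_combination \<B> X \<Longrightarrow> boolean_combination \<B> (- X)"
| union: "boolean_combination \<B> X \<Longrightarrow> boolean_combination \<B> Y \<Longrightarrow> boolean_combination \<B> (X \<union> Y)"

definition C_minimal ::
  "('f, 'r, 'a::field) fo_structure \<Rightarrow> ('a \<Rightarrow> 'g::linordered_ab_group_add extended) \<Rightarrow> bool" where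
  "C_minimal M v \<longleftrightarrow>
     (\<forall>X. definable M 1 X \<longrightarrow>
        boolean_combination ({B. is_ball v B} \<union> range (\<lambda>x. {x})) ((\<lambda>a. a 0) ` X))"

definition valuation_topology ::
  "('a::field \<Rightarrow> 'g::linordered_ab_group_add extended) \<Rightarrow> 'a topology" where
  "valuation_topology v = topology_generated_by {open_ball v c \<gamma> | c \<gamma>. True}"

abbreviation power_topology ::
  "('a::field \<Rightarrow> 'g::linordered_ab_group_add extended) \<Rightarrow> nat \<Rightarrow> (nat \<Rightarrow> 'a) topology" where
  "power_topology v k \<equiv> product_topology (\<lambda>_. valuation_topology v) {..<k}"

section \<open>Dp-rank\<close>

text \<open>
  An ict-pattern of depth \<open>n\<close> in \<open>X \<subseteq> M\<^sup>k\<close>: formulas \<open>\<phi>\<^sub>i(x; y)\<close> and parameters \<open>b\<^sub>i\<^sub>j\<close>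
  (\<open>i < n\<close>, \<open>j < \<omega>\<close>) such that for every \<open>\<eta>\<close> some \<open>a \<in> X\<close> satisfies \<open>\<phi>\<^sub>i(x; b\<^sub>i\<^sub>j)\<close>
  exactly when \<open>j = \<eta>(i)\<close>. Realising the patterns in \<open>M\<close> itself, rather than in an elementary
  extension, is legitimate when \<open>M\<close> is a monster model and \<open>X\<close> is definable.
\<close>

definition ict_pattern_in ::
  "('f, 'r, 'a) fo_structure \<Rightarrow> nat \<Rightarrow> (nat \<Rightarrow> 'a) set \<Rightarrow> nat \<Rightarrow> bool" where
  "ict_pattern_in M k X n \<longleftrightarrow>
     (\<exists>(\<phi> :: nat \<Rightarrow> ('f, 'r) fo_formula) (b :: nat \<Rightarrow> nat \<Rightarrow> nat \<Rightarrow> 'a).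
        (\<forall>i<n. wf_formula M (\<phi> i)) \<and>
        (\<forall>\<eta> :: nat \<Rightarrow> nat. \<exists>a \<in> X. \<forall>i<n. \<forall>j.
           sat M (tuple_env k a (b i j)) (\<phi> i) \<longleftrightarrow> j = \<eta> i))"

text \<open>The empty set has rank \<open>-\<infinity>\<close>, and all infinite ranks are identified with \<open>\<infinity>\<close>.\<close>

definition dp_rank :: "('f, 'r, 'a) fo_structure \<Rightarrow> nat \<Rightarrow> (nat \<Rightarrow> 'a) set \<Rightarrow> ereal" where
  "dp_rank M k X = (SUP n \<in> {n. ict_pattern_in M k X n}. ereal (real n))"

end

theory Submission
  imports Defs "HOL-Library.Ramsey"
begin

text \<open>
  Suppose that the set of bad points has rank \<open>k\<close>. A definable \<open>D \<subseteq> M\<^sup>k\<close> carrying \<open>ict\<close>-patterns of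
  depth \<open>k\<close> contains a box. Indeed, fixing a coordinate costs at most one row of a pattern
  (one-variable sets are cut out by boundedly many balls, and the balls around a point form a
  chain), so no such pattern lives on a set with finite fibres in some direction; hence \<open>D\<close> may be
  replaced, one direction at a time, by its points which are interior in that direction, with a
  uniform radius found by saturation. No exchange property is needed.

  By saturation again there are \<open>\<epsilon>\<close>, \<open>\<delta>\<close> and a set \<open>W\<close> of rank \<open>k\<close> on which \<open>f\<close> oscillates by more than
  \<open>\<epsilon>\<close> at \<open>(a, 0)\<close> although \<open>f(a, y)\<close> is \<open>\<epsilon>\<close>-close to \<open>g(a) = f(a, 0)\<close> for all \<open>y\<close> that are \<open>\<delta>\<close>-close to
  \<open>0\<close>. The \<open>\<epsilon>\<close>-neighbourhood of the graph of \<open>g\<close> over \<open>W\<close> has rank \<open>k + 1\<close>, so it contains a box. Over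
  that box \<open>g\<close> is constant up to \<open>\<epsilon>\<close>, and so \<open>f\<close> does not oscillate there.
\<close>

section \<open>Definable predicates\<close>

text \<open>The language has only the home sort, so a radius is given by a nonzero field element, as
  in \<open>v \<epsilon> < v (y - x)\<close>; statements about radii are then first order in
  \<open>M\<close>, and saturation applies to them. Interiority, oscillation and convergence come
  with radii that vary with the point, but each condition is monotone in its radius. A pattern of
  width N has finitely many paths and so needs one radius, and saturation bounds these radii for all
  N at once. Hence patterns are kept at every finite width, with finite Ramsey bounds that do not
  depend on parameters. The obstacle in fixing a coordinate is that one value has to serve every
  path through the remaining rows, whereas a pattern offers a different point on each path. Sliding
  windows remove it: a single point meets every row in the middle of a block, and the position of
  the window decides at which index it is met. The box for the neighbourhood of the graph forces
  \<open>g\<close> to be constant up to the scale because its points may share their last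
  coordinate, one element close to every value of \<open>g\<close> over the box.\<close>

primrec ren_term :: "(nat \<Rightarrow> nat) \<Rightarrow> 'f fo_term \<Rightarrow> 'f fo_term" where
  "ren_term \<tau> (Var i) = Var (\<tau> i)"
| "ren_term \<tau> (App s ts) = App s (map (ren_term \<tau>) ts)"

lemma eval_ren_term: "eval_term M e (ren_term \<tau> t) = eval_term M (e \<circ> \<tau>) t"
  by (induction t) (auto intro!: arg_cong[where f = "fun_int M _"])

lemma wf_ren_term: "wf_term M t \<Longrightarrow> wf_term M (ren_term \<tau> t)"
  by (induction t) (auto simp: list_all_iff)

lemma finite_fv_term: "finite (fv_term t)"
  by (induction t) auto

lemma finite_fv: "finite (fv \<phi>)"
  by (induction \<phi>) (auto simp: finite_fv_term)

lemma eval_term_cong: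
  "(\<And>i. i \<in> fv_term t \<Longrightarrow> e i = e' i) \<Longrightarrow> eval_term M e t = eval_term M e' t"
proof (induction t)
  case (App s ts)
  have "eval_term M e t = eval_term M e' t" if "t \<in> set ts" for t
    by (rule App.IH[OF that]) (use App.prems that in auto)
  then have "map (eval_term M e) ts = map (eval_term M e') ts"
    by simp
  then show ?case by (simp only: eval_term.simps)
qed simp

lemma sat_cong: "(\<And>i. i \<in> fv \<phi> \<Longrightarrow> e i = e' i) \<Longrightarrow> sat M e \<phi> \<longleftrightarrow> sat M e' \<phi>"
proof (induction \<phi> arbitrary: e e')
  case (Eq t u)
  then show ?case using eval_term_cong[of t e e' M] eval_term_cong[of u e e' M] by auto
next
  case (Rel r ts)
  then have "map (eval_term M e) ts = map (eval_term M e') ts"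
    by (auto intro!: eval_term_cong)
  then show ?case by (simp only: sat.simps)
next
  case (Neg \<phi>)
  have "sat M e \<phi> \<longleftrightarrow> sat M e' \<phi>"
    by (rule Neg.IH) (use Neg.prems in auto)
  then show ?case by simp
next
  case (Conj \<phi> \<psi>)
  have "sat M e \<phi> \<longleftrightarrow> sat M e' \<phi>" "sat M e \<psi> \<longleftrightarrow> sat M e' \<psi>"
    by (rule Conj.IH; use Conj.prems in auto)+
  then show ?case by simp
next
  case (Exi i \<phi>)
  have "sat M (e(i := x)) \<phi> \<longleftrightarrow> sat M (e'(i := x)) \<phi>" for x
    by (rule Exi.IH) (use Exi.prems in auto)
  then show ?case by simp
qed

text \<open>Bound variables are named, so a quantified variable is replaced by one outside the image
  of the free variables to avoid capture. The map \<open>\<tau>\<close> need not be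
  injective.\<close>

lemma ex_rename:
  "\<exists>\<psi>. (wf_formula M \<phi> \<longrightarrow> wf_formula M \<psi>) \<and> (\<forall>e. sat M e \<psi> \<longleftrightarrow> sat M (e \<circ> \<tau>) \<phi>)"
proof (induction \<phi> arbitrary: \<tau>)
  case (Eq t u)
  show ?case
    by (rule exI[of _ "Eq (ren_term \<tau> t) (ren_term \<tau> u)"]) (simp add: eval_ren_term[abs_def] wf_ren_term o_def)
next
  case (Rel r ts)
  show ?case
    by (rule exI[of _ "Rel r (map (ren_term \<tau>) ts)"])
      (simp add: eval_ren_term[abs_def] wf_ren_term list_all_iff o_def)
next
  case (Neg \<phi>)
  obtain \<psi> where "wf_formula M \<phi> \<longrightarrow> wf_formula M \<psi>" "\<And>e. sat M e \<psi> \<longleftrightarrow> sat M (e \<circ> \<tau>) \<phi>"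
    using Neg.IH[of \<tau>] by blast
  then show ?case by (intro exI[of _ "Neg \<psi>"]) (simp add: o_def)
next
  case (Conj \<phi>1 \<phi>2)
  obtain \<psi>1 where "wf_formula M \<phi>1 \<longrightarrow> wf_formula M \<psi>1"
      "\<And>e. sat M e \<psi>1 \<longleftrightarrow> sat M (e \<circ> \<tau>) \<phi>1"
    using Conj.IH(1)[of \<tau>] by blast
  moreover obtain \<psi>2 where "wf_formula M \<phi>2 \<longrightarrow> wf_formula M \<psi>2"
      "\<And>e. sat M e \<psi>2 \<longleftrightarrow> sat M (e \<circ> \<tau>) \<phi>2"
    using Conj.IH(2)[of \<tau>] by blast
  ultimately show ?case by (intro exI[of _ "Conj \<psi>1 \<psi>2"]) (simp add: o_def)
next
  case (Exi i \<phi>)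
  obtain j where j: "j \<notin> \<tau> ` fv \<phi>"
    using ex_new_if_finite[of "\<tau> ` fv \<phi>"] finite_fv by (auto simp: infinite_UNIV_nat)
  obtain \<psi> where \<psi>: "(wf_formula M \<phi> \<longrightarrow> wf_formula M \<psi>)"
      "\<And>e. sat M e \<psi> \<longleftrightarrow> sat M (e \<circ> \<tau>(i := j)) \<phi>"
    using Exi.IH[of "\<tau>(i := j)"] by blast
  have "sat M (e(j := x)) \<psi> \<longleftrightarrow> sat M ((e \<circ> \<tau>)(i := x)) \<phi>" for e x
    unfolding \<psi>(2) by (rule sat_cong) (use j in auto)
  then show ?case using \<psi>(1) by (intro exI[of _ "Exi j \<psi>"]) (simp add: o_def del: fun_upd_apply)
qed

lemma ex_Exi_finite:
  assumes "finite S"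
  shows "\<exists>\<psi>. (wf_formula M \<phi> \<longrightarrow> wf_formula M \<psi>) \<and>
    (\<forall>e. sat M e \<psi> \<longleftrightarrow> (\<exists>w. sat M (\<lambda>n. if n \<in> S then w n else e n) \<phi>))"
  using assms
proof (induction S)
  case empty
  show ?case by (rule exI[of _ \<phi>]) auto
next
  case (insert i S)
  then obtain \<psi> where \<psi>: "wf_formula M \<phi> \<longrightarrow> wf_formula M \<psi>"
    "\<And>e. sat M e \<psi> \<longleftrightarrow> (\<exists>w. sat M (\<lambda>n. if n \<in> S then w n else e n) \<phi>)"
    by blast
  have *: "(\<exists>x w. sat M (\<lambda>n. if n \<in> S then w n else (e(i := x)) n) \<phi>) \<longleftrightarrow>
      (\<exists>w. sat M (\<lambda>n. if n \<in> insert i S then w n else e n) \<phi>)" (is "?l \<longleftrightarrow> ?r") for e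
  proof
    assume ?l
    then obtain x w where "sat M (\<lambda>n. if n \<in> S then w n else (e(i := x)) n) \<phi>" by blast
    moreover have "(\<lambda>n. if n \<in> S then w n else (e(i := x)) n) =
        (\<lambda>n. if n \<in> insert i S then (w(i := x)) n else e n)"
      using insert.hyps by auto
    ultimately show ?r by metis
  next
    assume ?r
    then obtain w where "sat M (\<lambda>n. if n \<in> insert i S then w n else e n) \<phi>" by blast
    moreover have "(\<lambda>n. if n \<in> S then w n else (e(i := w i)) n) =
        (\<lambda>n. if n \<in> insert i S then w n else e n)"
      by auto
    ultimately show ?l by metis
  qed
  show ?case
    by (intro exI[of _ "Exi i \<psi>"] conjI impI allI)
      (simp_all only: sat.simps wf_formula.simps \<psi> *)
qed

text \<open>
  Definable predicates on environments over an arbitrary index type: \<open>T\<close> sends each variable of the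
  formula to an index or to a parameter. Tuples of several sorts, e.g. a point together with the
  parameters of a pattern, are then handled by sum and product index types.
\<close>

definition assignment :: "(nat \<Rightarrow> 'i + 'a) \<Rightarrow> ('i \<Rightarrow> 'a) \<Rightarrow> nat \<Rightarrow> 'a" where
  "assignment T e n = (case T n of Inl i \<Rightarrow> e i | Inr c \<Rightarrow> c)"

definition definable_pred :: "('f, 'r, 'a) fo_structure \<Rightarrow> (('i \<Rightarrow> 'a) \<Rightarrow> bool) \<Rightarrow> bool" where
  "definable_pred M P \<longleftrightarrow> (\<exists>\<phi> T. wf_formula M \<phi> \<and> (\<forall>e. P e \<longleftrightarrow> sat M (assignment T e) \<phi>))"

definition definable_term :: "('f, 'r, 'a) fo_structure \<Rightarrow> (('i \<Rightarrow> 'a) \<Rightarrow> 'a) \<Rightarrow> bool" where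
  "definable_term M f \<longleftrightarrow> (\<exists>t T. wf_term M t \<and> (\<forall>e. f e = eval_term M (assignment T e) t))"

text \<open>Interleaving on even and odd variables lets two formulas with unrelated assignments be
  combined into one.\<close>

definition join :: "(nat \<Rightarrow> 'b) \<Rightarrow> (nat \<Rightarrow> 'b) \<Rightarrow> nat \<Rightarrow> 'b" where
  "join S T n = (if even n then S (n div 2) else T (n div 2))"

lemma assignment_join:
  "assignment (join S T) e \<circ> (\<lambda>n. 2 * n) = assignment S e"
  "assignment (join S T) e \<circ> (\<lambda>n. Suc (2 * n)) = assignment T e"
  by (auto simp: assignment_def join_def fun_eq_iff)

lemma definable_term_var: "definable_term M (\<lambda>e. e i)"
  unfolding definable_term_def by (rule exI[of _ "Var 0"], rule exI[of _ "\<lambda>_. Inl i"]) (auto simp: assignment_def)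

lemma definable_term_const: "definable_term M (\<lambda>e. c)"
  unfolding definable_term_def by (rule exI[of _ "Var 0"], rule exI[of _ "\<lambda>_. Inr c"]) (auto simp: assignment_def)

lemma definable_term_pair:
  assumes "definable_term M f" "definable_term M g"
  obtains t u T where "wf_term M t" "wf_term M u" "\<And>e. f e = eval_term M (assignment T e) t"
    "\<And>e. g e = eval_term M (assignment T e) u"
proof -
  obtain t S where t: "wf_term M t" "\<And>e. f e = eval_term M (assignment S e) t"
    using assms(1) unfolding definable_term_def by blast
  obtain u T where u: "wf_term M u" "\<And>e. g e = eval_term M (assignment T e) u"
    using assms(2) unfolding definable_term_def by blast
  show ?thesis
    by (rule that[of "ren_term (\<lambda>n. 2 * n) t" "ren_term (\<lambda>n. Suc (2 * n)) u" "join S T"])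
      (simp_all add: t u wf_ren_term eval_ren_term assignment_join)
qed

lemma definable_term_unop:
  assumes "has_fun_symbol M 1 h" "definable_term M f"
  shows "definable_term M (\<lambda>e. h [f e])"
proof -
  obtain s where s: "fun_arity M s = 1" "\<And>xs. length xs = 1 \<Longrightarrow> fun_int M s xs = h xs"
    using assms(1) unfolding has_fun_symbol_def by blast
  obtain t T where "wf_term M t" "\<And>e. f e = eval_term M (assignment T e) t"
    using assms(2) unfolding definable_term_def by blast
  then show ?thesis unfolding definable_term_def
    by (intro exI[of _ "App s [t]"] exI[of _ T]) (simp add: s)
qed

lemma definable_term_binop:
  assumes "has_fun_symbol M 2 h" "definable_term M f" "definable_term M g"
  shows "definable_term M (\<lambda>e. h [f e, g e])"
proof -
  obtain s where s: "fun_arity M s = 2" "\<And>xs. length xs = 2 \<Longrightarrow> fun_int M s xs = h xs"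
    using assms(1) unfolding has_fun_symbol_def by blast
  obtain t u T where "wf_term M t" "wf_term M u" "\<And>e. f e = eval_term M (assignment T e) t"
    "\<And>e. g e = eval_term M (assignment T e) u"
    using definable_term_pair[OF assms(2,3)] by blast
  then show ?thesis unfolding definable_term_def
    by (intro exI[of _ "App s [t, u]"] exI[of _ T]) (simp add: s)
qed

lemma definable_pred_eq:
  assumes "definable_term M f" "definable_term M g"
  shows "definable_pred M (\<lambda>e. f e = g e)"
proof -
  obtain t u T where "wf_term M t" "wf_term M u" "\<And>e. f e = eval_term M (assignment T e) t"
    "\<And>e. g e = eval_term M (assignment T e) u"
    using definable_term_pair[OF assms] by blast
  then show ?thesis unfolding definable_pred_def
    by (intro exI[of _ "Eq t u"] exI[of _ T]) simp
qed

lemma definable_pred_binrel: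
  assumes "has_rel_symbol M 2 h" "definable_term M f" "definable_term M g"
  shows "definable_pred M (\<lambda>e. h [f e, g e])"
proof -
  obtain s where s: "rel_arity M s = 2" "\<And>xs. length xs = 2 \<Longrightarrow> rel_int M s xs = h xs"
    using assms(1) unfolding has_rel_symbol_def by blast
  obtain t u T where "wf_term M t" "wf_term M u" "\<And>e. f e = eval_term M (assignment T e) t"
    "\<And>e. g e = eval_term M (assignment T e) u"
    using definable_term_pair[OF assms(2,3)] by blast
  then show ?thesis unfolding definable_pred_def
    by (intro exI[of _ "Rel s [t, u]"] exI[of _ T]) (simp add: s)
qed

lemma definable_pred_not: "definable_pred M P \<Longrightarrow> definable_pred M (\<lambda>e. \<not> P e)"
  unfolding definable_pred_def by (metis sat.simps(3) wf_formula.simps(3))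

lemma definable_pred_conj:
  assumes "definable_pred M P" "definable_pred M Q"
  shows "definable_pred M (\<lambda>e. P e \<and> Q e)"
proof -
  obtain \<phi> S where \<phi>: "wf_formula M \<phi>" "\<And>e. P e \<longleftrightarrow> sat M (assignment S e) \<phi>"
    using assms(1) unfolding definable_pred_def by blast
  obtain \<psi> T where \<psi>: "wf_formula M \<psi>" "\<And>e. Q e \<longleftrightarrow> sat M (assignment T e) \<psi>"
    using assms(2) unfolding definable_pred_def by blast
  obtain \<phi>' where \<phi>': "wf_formula M \<phi>'" "\<And>e. sat M e \<phi>' \<longleftrightarrow> sat M (e \<circ> (\<lambda>n. 2 * n)) \<phi>"
    using ex_rename[of M \<phi>] \<phi>(1) by blast
  obtain \<psi>' where \<psi>': "wf_formula M \<psi>'" "\<And>e. sat M e \<psi>' \<longleftrightarrow> sat M (e \<circ> (\<lambda>n. Suc (2 * n))) \<psi>"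
    using ex_rename[of M \<psi>] \<psi>(1) by blast
  show ?thesis unfolding definable_pred_def
    by (rule exI[of _ "Conj \<phi>' \<psi>'"], rule exI[of _ "join S T"])
      (simp add: \<phi>' \<psi>' \<phi>(2) \<psi>(2) assignment_join)
qed

lemma definable_pred_const:
  fixes M :: "('f, 'r, 'a) fo_structure"
  shows "definable_pred M (\<lambda>e::'i \<Rightarrow> 'a. c)"
proof -
  have *: "definable_pred M (\<lambda>e::'i \<Rightarrow> 'a. undefined = (undefined :: 'a))"
    by (intro definable_pred_eq definable_term_const)
  show ?thesis using * definable_pred_not[OF *] by (cases c) simp_all
qed

lemma definable_pred_imp: "definable_pred M P \<Longrightarrow> definable_pred M Q \<Longrightarrow> definable_pred M (\<lambda>e. P e \<longrightarrow> Q e)"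
  using definable_pred_not[OF definable_pred_conj[OF _ definable_pred_not, of M P Q]] by simp

lemma definable_pred_iff: "definable_pred M P \<Longrightarrow> definable_pred M Q \<Longrightarrow> definable_pred M (\<lambda>e. P e \<longleftrightarrow> Q e)"
  using definable_pred_conj[OF definable_pred_imp[of M P Q] definable_pred_imp[of M Q P]] by (simp add: iff_conv_conj_imp)

lemma definable_pred_finite_ball:
  "finite S \<Longrightarrow> (\<And>i. i \<in> S \<Longrightarrow> definable_pred M (P i)) \<Longrightarrow> definable_pred M (\<lambda>e. \<forall>i\<in>S. P i e)"
  by (induction S rule: finite_induct) (simp_all add: definable_pred_const definable_pred_conj)

lemma definable_pred_all_less: "(\<And>i. i < n \<Longrightarrow> definable_pred M (P i)) \<Longrightarrow> definable_pred M (\<lambda>e. \<forall>i<(n::nat). P i e)"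
  using definable_pred_finite_ball[OF finite_lessThan, of n M P] unfolding Ball_def lessThan_iff .

text \<open>The formula stays and only the map from variables to indices changes; this is how
  predicates pass between index types.\<close>

lemma definable_pred_subst:
  assumes "definable_pred M P" and \<tau>: "\<And>i. (\<exists>j. \<forall>e. \<tau> e i = e j) \<or> (\<exists>c. \<forall>e. \<tau> e i = c)"
  shows "definable_pred M (\<lambda>e. P (\<tau> e))"
proof -
  obtain \<phi> T where \<phi>: "wf_formula M \<phi>" "\<And>e. P e \<longleftrightarrow> sat M (assignment T e) \<phi>"
    using assms(1) unfolding definable_pred_def by blast
  have "\<exists>t. \<forall>e. \<tau> e i = (case t of Inl j \<Rightarrow> e j | Inr c \<Rightarrow> c)" for i
    using \<tau>[of i] by (metis old.sum.simps(5) old.sum.simps(6))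
  then obtain S where S: "\<And>i e. \<tau> e i = (case S i of Inl j \<Rightarrow> e j | Inr c \<Rightarrow> c)"
    by metis
  have "assignment T (\<tau> e) = assignment (\<lambda>n. case T n of Inl i \<Rightarrow> S i | Inr c \<Rightarrow> Inr c) e" for e
    by (auto simp: assignment_def S split: sum.splits)
  then show ?thesis unfolding definable_pred_def using \<phi> by auto
qed

text \<open>A whole family \<open>w\<close> over any index type may be quantified, because a formula
  mentions only finitely many of its entries.\<close>

lemma definable_pred_ex_case_sum:
  fixes P :: "('i + 'j \<Rightarrow> 'a) \<Rightarrow> bool"
  assumes "definable_pred M P"
  shows "definable_pred M (\<lambda>e. \<exists>w. P (case_sum e w))"
proof -
  obtain \<phi> T where \<phi>: "wf_formula M \<phi>" "\<And>e. P e \<longleftrightarrow> sat M (assignment T e) \<phi>"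
    using assms(1) unfolding definable_pred_def by blast
  \<comment> \<open>Several variables may denote the same quantified entry and must become one
    variable, hence the least representative. Quantified entries go to even numbers, everything else
    to odd ones.\<close>
  define \<tau> where "\<tau> n = (if \<exists>j. T n = Inl (Inr j) then 2 * (LEAST n'. T n' = T n) else 2 * n + 1)" for n
  obtain \<psi> where \<psi>: "wf_formula M \<psi>" "\<And>e. sat M e \<psi> \<longleftrightarrow> sat M (e \<circ> \<tau>) \<phi>"
    using ex_rename[of M \<phi>] \<phi>(1) by blast
  define S where "S = {n \<in> fv \<psi>. even n}"
  have "finite S" by (simp add: S_def finite_fv)
  from ex_Exi_finite[OF this, of M \<psi>] \<psi>(1)
  obtain \<theta> where \<theta>: "wf_formula M \<theta>"
    "\<And>e. sat M e \<theta> \<longleftrightarrow> (\<exists>w. sat M (\<lambda>n. if n \<in> S then w n else e n) \<psi>)" by blast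
  define T' where "T' n = (case T (n div 2) of Inl (Inl i) \<Rightarrow> Inl i | Inl (Inr j) \<Rightarrow> Inr undefined | Inr c \<Rightarrow> Inr c)" for n
  have "(\<exists>w. P (case_sum e w)) \<longleftrightarrow> sat M (assignment T' e) \<theta>" for e
  proof
    assume "\<exists>w. P (case_sum e w)"
    then obtain w where w: "sat M (assignment T (case_sum e w)) \<phi>" unfolding \<phi>(2) by blast
    define w' where "w' n = assignment T (case_sum e w) (n div 2)" for n
    have L: "T (LEAST n'. T n' = T n) = T n" for n by (rule LeastI) simp
    have "sat M (\<lambda>n. if even n then w' n else assignment T' e n) \<psi>"
      unfolding \<psi>(2)
    proof (rule iffD1[OF sat_cong w])
      fix n
      show "assignment T (case_sum e w) n = ((\<lambda>n. if even n then w' n else assignment T' e n) \<circ> \<tau>) n"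
        using L[of n] by (auto simp: \<tau>_def w'_def assignment_def T'_def split: sum.splits)
    qed
    moreover have "sat M (\<lambda>n. if even n then w' n else assignment T' e n) \<psi> \<longleftrightarrow>
       sat M (\<lambda>n. if n \<in> S then w' n else assignment T' e n) \<psi>"
      by (rule sat_cong) (auto simp: S_def)
    ultimately show "sat M (assignment T' e) \<theta>" unfolding \<theta>(2) by blast
  next
    assume "sat M (assignment T' e) \<theta>"
    then obtain w' where "sat M (\<lambda>n. if n \<in> S then w' n else assignment T' e n) \<psi>" unfolding \<theta>(2) by blast
    moreover have "sat M (\<lambda>n. if even n then w' n else assignment T' e n) \<psi> \<longleftrightarrow>
       sat M (\<lambda>n. if n \<in> S then w' n else assignment T' e n) \<psi>"
      by (rule sat_cong) (auto simp: S_def)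
    ultimately have *: "sat M ((\<lambda>n. if even n then w' n else assignment T' e n) \<circ> \<tau>) \<phi>"
      unfolding \<psi>(2) by simp
    define w where "w j = w' (2 * (LEAST n'. T n' = Inl (Inr j)))" for j
    have "sat M (assignment T (case_sum e w)) \<phi>"
    proof (rule iffD1[OF sat_cong *])
      fix n
      show "((\<lambda>n. if even n then w' n else assignment T' e n) \<circ> \<tau>) n = assignment T (case_sum e w) n"
        by (auto simp: \<tau>_def assignment_def T'_def w_def split: sum.splits)
    qed
    then show "\<exists>w. P (case_sum e w)" unfolding \<phi>(2) by blast
  qed
  then show ?thesis unfolding definable_pred_def using \<theta>(1) by blast
qed

lemma definable_pred_exf:
  assumes "definable_pred M (\<lambda>e. P (\<lambda>j. e (Inr j)) (\<lambda>i. e (Inl i)))"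
  shows "definable_pred M (\<lambda>e. \<exists>w. P w e)"
  using definable_pred_ex_case_sum[OF assms] by simp

lemma definable_pred_ex:
  assumes "definable_pred M (\<lambda>e. P (e (Inr ())) (\<lambda>i. e (Inl i)))"
  shows "definable_pred M (\<lambda>e. \<exists>x. P x e)"
proof -
  have "(\<exists>x. P x e) \<longleftrightarrow> (\<exists>w. P (w ()) e)" for e
  proof
    assume "\<exists>x. P x e"
    then obtain x where "P x e" ..
    then show "\<exists>w. P (w ()) e" by (intro exI[of _ "\<lambda>_. x"])
  qed blast
  then show ?thesis using definable_pred_ex_case_sum[OF assms] by simp
qed

lemma definable_pred_all:
  assumes "definable_pred M (\<lambda>e. P (e (Inr ())) (\<lambda>i. e (Inl i)))"
  shows "definable_pred M (\<lambda>e. \<forall>x. P x e)"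
  using definable_pred_not[OF definable_pred_ex[OF definable_pred_not[OF assms]]] by simp

section \<open>Finite support, definable fibres and saturation\<close>

lemma definable_pred_finite_support:
  fixes P :: "('i \<Rightarrow> 'a) \<Rightarrow> bool"
  assumes "definable_pred M P"
  obtains S where "finite S" "\<And>e e'. (\<And>i. i \<in> S \<Longrightarrow> e i = e' i) \<Longrightarrow> P e \<longleftrightarrow> P e'"
proof -
  obtain \<phi> T where \<phi>: "wf_formula M \<phi>" "\<And>e. P e \<longleftrightarrow> sat M (assignment T e) \<phi>"
    using assms(1) unfolding definable_pred_def by blast
  let ?S = "(\<lambda>n. projl (T n)) ` fv \<phi>"
  show ?thesis
  proof (rule that[of ?S])
    show "finite ?S" using finite_fv by blast
    fix e e' :: "'i \<Rightarrow> 'a" assume *: "\<And>i. i \<in> ?S \<Longrightarrow> e i = e' i"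
    show "P e \<longleftrightarrow> P e'" unfolding \<phi>(2)
    proof (rule sat_cong)
      fix n assume "n \<in> fv \<phi>"
      then have "projl (T n) \<in> ?S" by blast
      from *[OF this] show "assignment T e n = assignment T e' n" by (auto simp: assignment_def split: sum.splits)
    qed
  qed
qed

lemma definable_imp_definable_pred:
  fixes X :: "(nat \<Rightarrow> 'a) set"
  assumes "definable M n X"
  shows "definable_pred M (\<lambda>e. restrict e {..<n} \<in> X)"
proof -
  obtain \<phi> p where \<phi>: "wf_formula M \<phi>" "X = {a \<in> tuples n. sat M (tuple_env n a p) \<phi>}"
    using assms unfolding definable_def by blast
  have "tuple_env n (restrict e {..<n}) p = assignment (\<lambda>i. if i < n then Inl i else Inr (p i)) e" for e
    by (auto simp: tuple_env_def assignment_def)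
  moreover have "restrict e {..<n} \<in> tuples n" for e :: "nat \<Rightarrow> 'a"
    by auto
  ultimately show ?thesis unfolding definable_pred_def \<phi>(2) using \<phi>(1) by auto
qed

lemma definable_pred_imp_definable_fibre:
  assumes "definable_pred M P"
  shows "definable M 1 {a \<in> tuples 1. P (e(i := a 0))}"
proof -
  obtain \<phi> T where \<phi>: "wf_formula M \<phi>" "\<And>e. P e \<longleftrightarrow> sat M (assignment T e) \<phi>"
    using assms(1) unfolding definable_pred_def by blast
  define \<tau> where "\<tau> n = (if T n = Inl i then 0 else Suc n)" for n
  obtain \<psi> where \<psi>: "wf_formula M \<psi>" "\<And>e. sat M e \<psi> \<longleftrightarrow> sat M (e \<circ> \<tau>) \<phi>"
    using ex_rename[of M \<phi>] \<phi>(1) by blast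
  define p where "p n = assignment T e (n - 1)" for n
  have "tuple_env 1 a p \<circ> \<tau> = assignment T (e(i := a 0))" for a
    by (auto simp: tuple_env_def \<tau>_def p_def assignment_def fun_eq_iff split: sum.splits)
  then show ?thesis unfolding definable_def
    by (intro exI[of _ \<psi>] exI[of _ p]) (simp add: \<psi> \<phi>(2))
qed

text \<open>Saturation speaks of tuples, so the common finite support \<open>S\<close> is enumerated
  by \<open>h\<close> and all other variables become parameters. Countably many formulas use
  countably many parameters, fewer than \<open>\<kappa>\<close> because
  \<open>natLeq <o \<kappa>\<close>.\<close>

lemma definable_pred_compactness:
  fixes F :: "nat \<Rightarrow> ('i \<Rightarrow> 'a) \<Rightarrow> bool" and M :: "('f, 'r, 'a) fo_structure"
  assumes mm: "monster_model \<kappa> M"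
    and F: "\<And>m. definable_pred M (F m)"
    and S: "finite S" "\<And>m e e'. (\<And>i. i \<in> S \<Longrightarrow> e i = e' i) \<Longrightarrow> F m e \<longleftrightarrow> F m e'"
    and fin: "\<And>m. \<exists>e. \<forall>m'\<le>m. F m' e"
  shows "\<exists>e. \<forall>m. F m e"
proof -
  obtain h where h: "bij_betw h S {..<card S}"
    using ex_bij_betw_finite_nat[OF S(1)] by (auto simp: atLeast0LessThan)
  define n where "n = card S"
  let ?g = "inv_into S h"
  have gh: "?g (h s) = s" "h s < n" if "s \<in> S" for s
    using h that by (auto simp: bij_betw_def n_def)
  have "\<exists>\<psi> p. wf_formula M \<psi> \<and> (\<forall>a. F m (\<lambda>s. if s \<in> S then a (h s) else undefined) \<longleftrightarrow> sat M (tuple_env n a p) \<psi>)" for m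
  proof -
    obtain \<phi> T where \<phi>: "wf_formula M \<phi>" "\<And>e. F m e \<longleftrightarrow> sat M (assignment T e) \<phi>"
      using F[of m] unfolding definable_pred_def by blast
    define \<tau> where "\<tau> k = (if \<exists>s\<in>S. T k = Inl s then h (projl (T k)) else n + k)" for k
    define p where "p k = assignment T (\<lambda>_. undefined) (k - n)" for k
    obtain \<psi> where \<psi>: "wf_formula M \<psi>" "\<And>e. sat M e \<psi> \<longleftrightarrow> sat M (e \<circ> \<tau>) \<phi>"
      using ex_rename[of M \<phi>] \<phi>(1) by blast
    have "tuple_env n a p \<circ> \<tau> = assignment T (\<lambda>s. if s \<in> S then a (h s) else undefined)" for a
      using gh by (auto simp: tuple_env_def \<tau>_def p_def assignment_def fun_eq_iff split: sum.splits)
    then show ?thesis using \<psi>(1) by (intro exI[of _ \<psi>] exI[of _ p]) (simp add: \<phi>(2) \<psi>(2))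
  qed
  then obtain \<psi> p where \<psi>: "\<And>m. wf_formula M (\<psi> m)"
    "\<And>m a. F m (\<lambda>s. if s \<in> S then a (h s) else undefined) \<longleftrightarrow> sat M (tuple_env n a (p m)) (\<psi> m)"
    by metis
  define A where "A = (\<Union>m. p m ` fv (\<psi> m))"
  define \<Sigma> where "\<Sigma> = range (\<lambda>m. (\<psi> m, p m))"
  have "countable A" unfolding A_def by (intro countable_UN) (auto intro: countable_finite finite_fv)
  then have "|A| \<le>o natLeq"
    by (meson card_of_nat card_of_ordLeq countableE ordLeq_ordIso_trans top_greatest)
  then have A: "|A| <o \<kappa>" using mm unfolding monster_model_def by (meson ordLeq_ordLess_trans)
  have "\<exists>a \<in> tuples n. \<forall>(\<phi>, p) \<in> \<Sigma>. sat M (tuple_env n a p) \<phi>"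
  proof -
    have sa: "saturated \<kappa> M" using mm unfolding monster_model_def by blast
    have 1: "\<forall>(\<phi>, p) \<in> \<Sigma>. wf_formula M \<phi> \<and> (\<forall>i \<in> fv \<phi>. i < n \<or> p i \<in> A)"
      unfolding \<Sigma>_def A_def using \<psi>(1) by blast
    have 2: "\<forall>G \<subseteq> \<Sigma>. finite G \<longrightarrow> (\<exists>a \<in> tuples n. \<forall>(\<phi>, p) \<in> G. sat M (tuple_env n a p) \<phi>)"
    proof (intro allI impI)
      fix G assume "G \<subseteq> \<Sigma>" "finite G"
      then obtain K where K: "finite K" "G = (\<lambda>m. (\<psi> m, p m)) ` K"
        unfolding \<Sigma>_def by (meson finite_subset_image)
      obtain k where k: "\<And>m. m \<in> K \<Longrightarrow> m \<le> k"
        using K(1) finite_nat_set_iff_bounded_le by auto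
      obtain e where e: "\<And>m. m \<le> k \<Longrightarrow> F m e" using fin[of k] by blast
      define a where "a = restrict (\<lambda>i. e (?g i)) {..<n}"
      have "sat M (tuple_env n a (p m)) (\<psi> m)" if "m \<in> K" for m
        unfolding \<psi>(2)[symmetric]
        by (rule iffD1[OF S(2) e[OF k[OF that]]]) (use gh in \<open>auto simp: a_def\<close>)
      then show "\<exists>a \<in> tuples n. \<forall>(\<phi>, p) \<in> G. sat M (tuple_env n a p) \<phi>"
        unfolding K(2) by (intro bexI[of _ a]) (auto simp: a_def)
    qed
    show ?thesis
      using sa[unfolded saturated_def, THEN spec[of _ A], THEN spec[of _ n], THEN spec[of _ \<Sigma>]]
        A 1 2 by blast
  qed
  then obtain a where "\<And>m. sat M (tuple_env n a (p m)) (\<psi> m)"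
    unfolding \<Sigma>_def by auto
  then show ?thesis unfolding \<psi>(2)[symmetric] by blast
qed

section \<open>Fibres of definable predicates and balls\<close>

lemma valuation_one:
  assumes "valuation v" shows "v 1 = (0 :: 'g::linordered_ab_group_add extended)"
proof -
  have m: "v (x * y) = v x + v y" for x y using assms unfolding valuation_def by blast
  have "v 1 \<noteq> Pinf" using assms unfolding valuation_def by (metis zero_neq_one)
  moreover have "v 1 \<in> insert Pinf (range Fin)" using assms unfolding valuation_def by blast
  ultimately obtain h where h: "v 1 = Fin h" by blast
  have "v 1 = v 1 + v 1" using m[of 1 1] by simp
  then have "h = 0" unfolding h by simp
  then show ?thesis using h by (simp add: zero_extended_def)
qed

text \<open>Twice the value of -1 is \<open>v 1 = 0\<close>, and an ordered group has no
  torsion.\<close>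

lemma valuation_uminus:
  assumes "valuation v" shows "v (- x) = (v x :: 'g::linordered_ab_group_add extended)"
proof -
  have m: "v (x * y) = v x + v y" for x y using assms unfolding valuation_def by blast
  have "v (- 1) \<noteq> Pinf" using assms unfolding valuation_def by (metis neg_equal_0_iff_equal zero_neq_one)
  moreover have "v (- 1) \<in> insert Pinf (range Fin)" using assms unfolding valuation_def by blast
  ultimately obtain h where h: "v (- 1) = Fin h" by blast
  have "v (- 1) + v (- 1) = 0" using m[of "- 1" "- 1"] valuation_one[OF assms] by simp
  then have "h + h = 0" unfolding h by (simp add: zero_extended_def)
  then have "v (- 1) = 0" using h by (simp add: zero_extended_def)
  then show ?thesis using m[of "- 1" x] h by (cases "v x") (simp_all add: zero_extended_def)
qed

text \<open>
  \<open>x\<close> and \<open>y\<close> lie in the same ones of the closed and the open ball around \<open>c\<close> of radius \<open>v r\<close>. Points are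
  covered by \<open>r = 0\<close>, as \<open>v 0 = \<infinity>\<close>.
\<close>

definition same :: "('a::field \<Rightarrow> 'g::linordered_ab_group_add extended) \<Rightarrow> 'a \<Rightarrow> 'a \<Rightarrow> 'a \<Rightarrow> 'a \<Rightarrow> bool"
  where "same v c r x y \<longleftrightarrow> (v r \<le> v (x - c) \<longleftrightarrow> v r \<le> v (y - c)) \<and> (v r < v (x - c) \<longleftrightarrow> v r < v (y - c))"

text \<open>A substitute for boolean combinations of \<open>m\<close> balls that is first order for
  each fixed \<open>m\<close>, as needed for a bound by saturation. Only the first \<open>m\<close>
  entries of \<open>c\<close> and \<open>r\<close> count.\<close>

definition coded :: "('a::field \<Rightarrow> 'g::linordered_ab_group_add extended) \<Rightarrow> nat \<Rightarrow> 'a set \<Rightarrow> bool" where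
  "coded v m X \<longleftrightarrow> (\<exists>c r. \<forall>x y. (\<forall>l<m. same v (c l) (r l) x y) \<longrightarrow> (x \<in> X \<longleftrightarrow> y \<in> X))"

lemma codedI:
  assumes "\<And>x y. (\<forall>l<m. same v (c l) (r l) x y) \<Longrightarrow> x \<in> X \<longleftrightarrow> y \<in> X"
  shows "coded v m X"
  unfolding coded_def
proof (intro exI allI impI)
  fix x y assume "\<forall>l<m. same v (c l) (r l) x y"
  then show "x \<in> X \<longleftrightarrow> y \<in> X" by (rule assms)
qed

lemma coded_mono:
  assumes "coded v m X" "m \<le> n" shows "coded v n X"
proof -
  obtain c r where "\<And>x y. (\<forall>l<m. same v (c l) (r l) x y) \<Longrightarrow> x \<in> X \<longleftrightarrow> y \<in> X"
    using assms(1) unfolding coded_def by blast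
  then show ?thesis using assms(2) by (intro codedI[of n v c r]) simp
qed

locale C_minimal_monster =
  fixes M :: "('f, 'r, 'a::alg_closed_field) fo_structure"
    and \<kappa> :: "'c rel"
    and v :: "'a \<Rightarrow> 'g::linordered_ab_group_add extended"
  assumes mm: "monster_model \<kappa> M"
    and ac: "ACVF_expansion M v"
    and cm: "C_minimal M v"
begin

section \<open>Ultrametric inequalities and the choice of radii\<close>

lemma val: "valuation v"
  using ac unfolding ACVF_expansion_def by blast

lemma v_eq_Pinf_iff: "v x = Pinf \<longleftrightarrow> x = 0"
  using val unfolding valuation_def by blast

lemma v_zero [simp]: "v 0 = Pinf"
  by (simp add: v_eq_Pinf_iff)

lemma v_ex_Fin: "x \<noteq> 0 \<Longrightarrow> \<exists>g. v x = Fin g"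
  using val v_eq_Pinf_iff[of x] unfolding valuation_def by (metis image_iff insert_iff rangeI)

lemma ex_v_Fin: "\<exists>x. x \<noteq> 0 \<and> v x = Fin g"
  using val v_eq_Pinf_iff unfolding valuation_def
  by (metis (no_types, lifting) extended.distinct(1) image_iff insert_iff rangeI v_zero)

lemma v_uminus: "v (- x) = v x"
  using val by (rule valuation_uminus)

lemma v_diff_commute: "v (x - y) = v (y - x)"
  using v_uminus[of "x - y"] by simp

lemma v_add_ge: "c \<le> v x \<Longrightarrow> c \<le> v y \<Longrightarrow> c \<le> v (x + y)"
  using val unfolding valuation_def by (meson min.boundedI order_trans)

lemma v_add_gt: "c < v x \<Longrightarrow> c < v y \<Longrightarrow> c < v (x + y)"
  using val unfolding valuation_def by (meson min_less_iff_conj less_le_trans)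

lemma v_diff_gt_trans: "c < v (x - y) \<Longrightarrow> c < v (y - z) \<Longrightarrow> c < v (x - z)"
  using v_add_gt[of c "x - y" "y - z"] by simp

lemma v_diff_ge_trans: "c \<le> v (x - y) \<Longrightarrow> c \<le> v (y - z) \<Longrightarrow> c \<le> v (x - z)"
  using v_add_ge[of c "x - y" "y - z"] by simp

lemma v_less_Pinf_iff: "v x < Pinf \<longleftrightarrow> x \<noteq> 0"
  using v_ex_Fin[of x] by (cases "x = 0") auto

lemma ex_v_gt:
  assumes "c \<noteq> 0" shows "\<exists>c'. c' \<noteq> 0 \<and> v c < v c'"
proof -
  obtain x where x: "x \<noteq> 0" "v x \<noteq> 0" using ac unfolding ACVF_expansion_def by blast
  obtain h where h: "v x = Fin h" using v_ex_Fin[OF x(1)] by blast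
  have "h \<noteq> 0" using x(2) h by (auto simp: zero_extended_def)
  obtain g where g: "v c = Fin g" using v_ex_Fin[OF assms] by blast
  \<comment> \<open>The term \<open>max h (- h)\<close> is the absolute value of \<open>h\<close>,
    positive because the valuation is nontrivial.\<close>
  obtain c' where "c' \<noteq> 0" "v c' = Fin (g + max h (- h))" using ex_v_Fin by blast
  moreover have "g < g + max h (- h)"
    using \<open>h \<noteq> 0\<close> by (auto simp: less_max_iff_disj neq_iff)
  ultimately show ?thesis using g by auto
qed

text \<open>A larger value means a smaller ball, so this selects one radius that is good for
  finitely many conditions.\<close>

lemma ex_v_upper_bound:
  assumes "finite S" "0 \<notin> S" shows "\<exists>c. c \<noteq> 0 \<and> (\<forall>s\<in>S. v s \<le> v c)"
  using assms
proof (induction S)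
  case empty
  show ?case by (rule exI[of _ 1]) simp
next
  case (insert s S)
  then obtain c where c: "c \<noteq> 0" "\<forall>s\<in>S. v s \<le> v c" by auto
  show ?case
  proof (cases "v s \<le> v c")
    case True
    then show ?thesis using c by auto
  next
    case False
    then show ?thesis using c insert.prems by (intro exI[of _ s]) (auto intro: order_trans)
  qed
qed

text \<open>The values of the nonzero elements of a finite ball would have an upper bound, but
  nonzero elements of larger value always exist.\<close>

lemma infinite_v_gt: "c \<noteq> 0 \<Longrightarrow> infinite {x. v c < v x}"
proof
  assume c: "c \<noteq> 0" and fin: "finite {x. v c < v x}"
  let ?S = "{x. v c < v x} - {0}"
  have S: "finite ?S" "0 \<notin> ?S" using fin by auto
  obtain b where b: "b \<noteq> 0" "\<And>s. s \<in> ?S \<Longrightarrow> v s \<le> v b" using ex_v_upper_bound[OF S] by blast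
  obtain c' where c': "c' \<noteq> 0" "v c < v c'" using ex_v_gt[OF c] by blast
  obtain b' where b': "b' \<noteq> 0" "v b < v b'" using ex_v_gt[OF b(1)] by blast
  have "v c' \<le> v b" using b(2)[of c'] c' by simp
  then have "v c < v b'" using c'(2) b'(2) by order
  then have "v b' \<le> v b" using b(2)[of b'] b'(1) by simp
  then show False using b'(2) by order
qed

section \<open>Definability of the valued field operations\<close>

lemma definable_term_diff:
  assumes "definable_term M f" "definable_term M g" shows "definable_term M (\<lambda>e. f e - g e)"
proof -
  have "has_fun_symbol M 1 (\<lambda>xs. - (xs ! 0))" "has_fun_symbol M 2 (\<lambda>xs. xs ! 0 + xs ! 1)"
    using ac unfolding ACVF_expansion_def by blast+
  from definable_term_binop[OF this(2) assms(1) definable_term_unop[OF this(1) assms(2)]] show ?thesis by simp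
qed

lemma definable_term_add:
  assumes "definable_term M f" "definable_term M g" shows "definable_term M (\<lambda>e. f e + g e)"
proof -
  have "has_fun_symbol M 2 (\<lambda>xs. xs ! 0 + xs ! 1)"
    using ac unfolding ACVF_expansion_def by blast
  from definable_term_binop[OF this assms] show ?thesis by simp
qed

lemma definable_pred_v_le:
  assumes "definable_term M f" "definable_term M g" shows "definable_pred M (\<lambda>e. v (f e) \<le> v (g e))"
proof -
  have "has_rel_symbol M 2 (\<lambda>xs. v (xs ! 0) \<le> v (xs ! 1))"
    using ac unfolding ACVF_expansion_def by blast
  from definable_pred_binrel[OF this assms] show ?thesis by simp
qed

lemma definable_pred_v_less:
  assumes "definable_term M f" "definable_term M g" shows "definable_pred M (\<lambda>e. v (f e) < v (g e))"
  using definable_pred_not[OF definable_pred_v_le[OF assms(2,1)]] by (simp add: not_le)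

lemmas definable_pred_intros = definable_pred_const definable_pred_conj definable_pred_imp definable_pred_iff definable_pred_not definable_pred_all_less
  definable_pred_ex definable_pred_all definable_pred_exf definable_pred_eq definable_pred_v_le definable_pred_v_less
  definable_term_diff definable_term_add definable_term_var definable_term_const

section \<open>One-variable fibres are decided by uniformly few balls\<close>

lemma coded_boolean_combination:
  assumes "boolean_combination ({B. is_ball v B} \<union> range (\<lambda>x. {x})) X"
  shows "\<exists>m. coded v m X"
  using assms
proof (induction)
  case (base X)
  have "\<exists>c r. \<forall>x y. same v c r x y \<longrightarrow> (x \<in> X \<longleftrightarrow> y \<in> X)"
  proof (cases "is_ball v X")
    case True
    then obtain c g where *: "X = open_ball v c g \<or> X = closed_ball v c g"
      unfolding is_ball_def by blast
    obtain r where "v r = Fin g" using ex_v_Fin by blast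
    then show ?thesis
      using * by (intro exI[of _ c] exI[of _ r]) (auto simp: open_ball_def closed_ball_def same_def)
  next
    case False
    then obtain p where "X = {p}" using base by auto
    moreover have "v 0 \<le> v z \<longleftrightarrow> z = 0" for z
      using v_less_Pinf_iff[of z] by (simp flip: not_less)
    then have "same v p 0 x y \<Longrightarrow> x = p \<longleftrightarrow> y = p" for x y
      by (simp add: same_def del: v_zero)
    ultimately show ?thesis by blast
  qed
  then obtain c r where "\<And>x y. same v c r x y \<Longrightarrow> (x \<in> X \<longleftrightarrow> y \<in> X)" by blast
  then show ?case
    by (intro exI[of _ 1] codedI[of 1 v "\<lambda>_. c" "\<lambda>_. r"]) simp
next
  case empty
  show ?case by (simp add: coded_def)
next
  case (compl X)
  then show ?case by (simp add: coded_def)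
next
  case (union X Y)
  obtain m n where mn: "coded v m X" "coded v n Y"
    using union.IH by blast
  obtain c r where X: "\<And>x y. (\<forall>l<m. same v (c l) (r l) x y) \<Longrightarrow> (x \<in> X \<longleftrightarrow> y \<in> X)"
    using mn(1) unfolding coded_def by blast
  obtain d s where Y: "\<And>x y. (\<forall>l<n. same v (d l) (s l) x y) \<Longrightarrow> (x \<in> Y \<longleftrightarrow> y \<in> Y)"
    using mn(2) unfolding coded_def by blast
  let ?c = "\<lambda>l. if l < m then c l else d (l - m)" and ?r = "\<lambda>l. if l < m then r l else s (l - m)"
  have "x \<in> X \<union> Y \<longleftrightarrow> y \<in> X \<union> Y" if *: "\<forall>l<m + n. same v (?c l) (?r l) x y" for x y
  proof -
    have "x \<in> X \<longleftrightarrow> y \<in> X"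
    proof (rule X)
      show "\<forall>l<m. same v (c l) (r l) x y" using *[THEN spec] by (metis trans_less_add1)
    qed
    moreover have "x \<in> Y \<longleftrightarrow> y \<in> Y"
    proof (rule Y)
      show "\<forall>l<n. same v (d l) (s l) x y" using *[THEN spec, of "m + _"] by simp
    qed
    ultimately show ?thesis by blast
  qed
  then show ?case by (intro exI[of _ "m + n"] codedI[of "m + n" v ?c ?r])
qed

lemma definable_pred_same:
  "definable_term M c \<Longrightarrow> definable_term M r \<Longrightarrow> definable_term M f \<Longrightarrow> definable_term M g \<Longrightarrow> definable_pred M (\<lambda>e. same v (c e) (r e) (f e) (g e))"
  unfolding same_def by (intro definable_pred_intros)

lemma definable_pred_update:
  fixes P :: "('i \<Rightarrow> 'a) \<Rightarrow> bool"
  assumes "definable_pred M P"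
  shows "definable_pred M (\<lambda>e. P ((\<lambda>j. e (h j))(i := e k)))"
proof (rule definable_pred_subst[OF assms])
  fix j
  show "(\<exists>j'. \<forall>e. ((\<lambda>j. e (h j))(i := e k)) j = e j') \<or> (\<exists>c. \<forall>e. ((\<lambda>j. e (h j))(i := e k)) j = c)"
    by (cases "j = i") auto
qed

text \<open>Otherwise the conditions "the fibre is not coded by \<open>m\<close> pairs" would be
  finitely satisfiable, by monotonicity in \<open>m\<close>, and saturation would yield one fibre
  violating all of them, contrary to C-minimality.\<close>

lemma coded_uniform:
  fixes P :: "('i \<Rightarrow> 'a) \<Rightarrow> bool"
  assumes P: "definable_pred M P"
  shows "\<exists>m. \<forall>e. coded v m {x. P (e(i := x))}"
proof (rule ccontr)
  define F where "F m e \<longleftrightarrow> \<not> coded v m {x. P (e(i := x))}" for m e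
  have F: "definable_pred M (F m)" for m
    unfolding F_def coded_def mem_Collect_eq by (intro definable_pred_intros definable_pred_same definable_pred_update[OF P])
  obtain S where S: "finite S" "\<And>e e'. (\<And>i. i \<in> S \<Longrightarrow> e i = e' i) \<Longrightarrow> P e \<longleftrightarrow> P e'"
    using definable_pred_finite_support[OF P] by blast
  have FS: "F m e \<longleftrightarrow> F m e'" if "\<And>i. i \<in> S \<Longrightarrow> e i = e' i" for m e e'
  proof -
    have "P (e(i := x)) \<longleftrightarrow> P (e'(i := x))" for x by (rule S(2)) (use that in auto)
    then show ?thesis by (simp add: F_def)
  qed
  assume "\<not> ?thesis"
  then have "\<exists>e. \<forall>m'\<le>m. F m' e" for m
    unfolding F_def using coded_mono by blast
  then obtain e where "\<And>m. F m e"
    using definable_pred_compactness[of \<kappa> M F S, OF mm F S(1) FS] by blast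
  moreover have *: "(\<lambda>a. a 0) ` {a \<in> tuples 1. P (e(i := a 0))} = {x. P (e(i := x))}"
  proof (intro equalityI subsetI)
    fix x assume "x \<in> {x. P (e(i := x))}"
    then show "x \<in> (\<lambda>a. a 0) ` {a \<in> tuples 1. P (e(i := a 0))}"
      by (intro image_eqI[of _ _ "restrict (\<lambda>_. x) {..<1}"]) auto
  qed auto
  have "boolean_combination ({B. is_ball v B} \<union> range (\<lambda>x. {x})) {x. P (e(i := x))}"
    using cm[unfolded C_minimal_def, THEN spec, THEN mp, OF definable_pred_imp_definable_fibre[OF P, of e i]]
    unfolding * .
  ultimately show False using coded_boolean_combination unfolding F_def by blast
qed

text \<open>If \<open>y\<close> is closer to \<open>x\<close> than every centre is, then
  \<open>y\<close> and \<open>x\<close> have equal distance to each centre, whatever the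
  radii.\<close>

lemma same_near:
  assumes "x \<notin> c ` {..<m::nat}"
  shows "\<exists>\<epsilon>. \<epsilon> \<noteq> 0 \<and> (\<forall>y. v \<epsilon> < v (y - x) \<longrightarrow> (\<forall>l<m. same v (c l) (r l) x y))"
proof -
  have "finite ((\<lambda>l. x - c l) ` {..<m})" "0 \<notin> (\<lambda>l. x - c l) ` {..<m}"
    using assms by auto
  from ex_v_upper_bound[OF this] obtain \<epsilon> where e: "\<epsilon> \<noteq> 0" "\<And>l. l < m \<Longrightarrow> v (x - c l) \<le> v \<epsilon>"
    by auto
  have "same v (c l) (r l) x y" if "v \<epsilon> < v (y - x)" "l < m" for y l
  proof -
    have *: "v (x - c l) < v (y - x)" using e(2)[OF that(2)] that(1) by order
    have "v (y - c l) = v (x - c l)"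
    proof (rule antisym)
      show "v (x - c l) \<le> v (y - c l)"
        using v_diff_ge_trans[of "v (x - c l)" y x "c l"] * by simp
      show "v (y - c l) \<le> v (x - c l)"
      proof (rule ccontr)
        assume "\<not> ?thesis"
        then have "v (x - c l) < v (y - c l)" by simp
        moreover have "v (x - c l) < v (x - y)" using * by (simp add: v_diff_commute)
        ultimately have "v (x - c l) < v (x - c l)" by (rule v_diff_gt_trans[rotated])
        then show False by simp
      qed
    qed
    then show ?thesis by (simp add: same_def)
  qed
  then show ?thesis using e(1) by blast
qed

text \<open>By \<open>same_near\<close>, a point of a fibre that is not interior to it is one of the
  \<open>m\<close> centres which code the fibre.\<close>

lemma boundary_bound:
  fixes P :: "('i \<Rightarrow> 'a) \<Rightarrow> bool"
  assumes "definable_pred M P"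
  shows "\<exists>m. \<forall>e A. A \<subseteq> {x. P (e(i := x)) \<and>
    (\<nexists>\<epsilon>. \<epsilon> \<noteq> 0 \<and> (\<forall>y. v \<epsilon> < v (y - x) \<longrightarrow> P (e(i := y))))} \<longrightarrow> finite A \<and> card A \<le> m"
proof -
  obtain m where m: "\<And>e. coded v m {x. P (e(i := x))}"
    using coded_uniform[OF assms] by blast
  have *: "finite A \<and> card A \<le> m"
    if A: "A \<subseteq> {x. P (e(i := x)) \<and> (\<nexists>\<epsilon>. \<epsilon> \<noteq> 0 \<and> (\<forall>y. v \<epsilon> < v (y - x) \<longrightarrow> P (e(i := y))))}" for e A
  proof -
    obtain c r where cr: "\<And>x y. (\<forall>l<m. same v (c l) (r l) x y) \<Longrightarrow> P (e(i := x)) \<longleftrightarrow> P (e(i := y))"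
      using m[of e] unfolding coded_def mem_Collect_eq by blast
    have "A \<subseteq> c ` {..<m}"
    proof (rule ccontr)
      assume "\<not> ?thesis"
      then obtain x where x: "x \<in> A" "x \<notin> c ` {..<m}" by blast
      from same_near[OF x(2)] obtain \<epsilon>
        where "\<epsilon> \<noteq> 0" "\<And>y l. v \<epsilon> < v (y - x) \<Longrightarrow> l < m \<Longrightarrow> same v (c l) (r l) x y" by blast
      then show False using x(1) A cr[of x] by blast
    qed
    then show ?thesis
      using card_mono[of "c ` {..<m}" A] card_image_le[of "{..<m}" c] finite_subset by fastforce
  qed
  show ?thesis by (intro exI[of _ m] allI impI) (rule *)
qed

end

section \<open>Ramsey lemmas\<close>

lemma sorted_list_of_set_image_strict_mono:
  fixes g :: "nat \<Rightarrow> 'b::linorder"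
  assumes "strict_mono_on {..<r} g"
  shows "sorted_list_of_set (g ` {..<r}) = map g [0..<r]"
proof -
  have "sorted_wrt (<) (map g [0..<r])"
    using assms by (auto simp: sorted_wrt_iff_nth_less strict_mono_on_def)
  then have "sorted (map g [0..<r])" "distinct (map g [0..<r])"
    by (auto simp: strict_sorted_iff)
  from sorted_list_of_set.idem_if_sorted_distinct[OF this] show ?thesis
    by (simp add: atLeast0LessThan)
qed

text \<open>Subsets of size \<open>r\<close> are read as their increasing enumerations.
  \<open>N\<close> is chosen before the colouring, so that later bounds are uniform in the
  parameters.\<close>

lemma ramsey_strict_mono:
  fixes Col :: "'c set" and n r :: nat
  assumes "finite Col"
  shows "\<exists>N. \<forall>F :: (nat \<Rightarrow> nat) \<Rightarrow> 'c. (\<forall>g. F g \<in> Col) \<longrightarrow>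
    (\<forall>g g'. (\<forall>i<r. g i = g' i) \<longrightarrow> F g = F g') \<longrightarrow>
    (\<exists>h c. strict_mono_on {..<n} h \<and> h ` {..<n} \<subseteq> {..<N} \<and>
      (\<forall>g. strict_mono_on {..<r} g \<longrightarrow> g ` {..<r} \<subseteq> {..<n} \<longrightarrow> F (\<lambda>i. h (g i)) = c))"
proof -
  obtain \<beta> where \<beta>: "bij_betw \<beta> Col {..<card Col}"
    using ex_bij_betw_finite_nat[OF assms] by (auto simp: atLeast0LessThan)
  obtain N :: nat where N: "partn_lst {..<N} (replicate (card Col) n) r"
    using ramsey_full by blast
  have "\<exists>h c. strict_mono_on {..<n} h \<and> h ` {..<n} \<subseteq> {..<N} \<and>
      (\<forall>g. strict_mono_on {..<r} g \<longrightarrow> g ` {..<r} \<subseteq> {..<n} \<longrightarrow> F (\<lambda>i. h (g i)) = c)"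
    if F: "\<And>g. F g \<in> Col" "\<And>g g'. (\<And>i. i < r \<Longrightarrow> g i = g' i) \<Longrightarrow> F g = F g'"
    for F :: "(nat \<Rightarrow> nat) \<Rightarrow> 'c"
  proof -
    define f where "f K = \<beta> (F (\<lambda>i. sorted_list_of_set K ! i))" for K
    have "f \<in> nsets {..<N} r \<rightarrow> {..<card Col}"
      unfolding f_def using F(1) \<beta> by (auto simp: bij_betw_def)
    from partn_lstE[OF N this] obtain i H where i: "i < card Col"
      and H: "H \<in> nsets {..<N} (replicate (card Col) n ! i)" "f ` nsets H r \<subseteq> {i}"
      by (metis length_replicate)
    have H': "H \<subseteq> {..<N}" "finite H" "card H = n" using H(1) i by (auto simp: nsets_def)
    define h where "h j = sorted_list_of_set H ! j" for j
    have hmono: "strict_mono_on {..<n} h"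
      unfolding h_def using H'(3) sorted_list_of_set.strict_sorted_key_list_of_set[of H]
      by (auto simp: strict_mono_on_def sorted_wrt_iff_nth_less)
    have hH: "h ` {..<n} \<subseteq> H"
      unfolding h_def using H'(2,3)
      by (metis (no_types, lifting) image_subsetI lessThan_iff nth_mem
          sorted_list_of_set.length_sorted_key_list_of_set sorted_list_of_set.set_sorted_key_list_of_set)
    have "F (\<lambda>j. h (g j)) = inv_into Col \<beta> i"
      if g: "strict_mono_on {..<r} g" "g ` {..<r} \<subseteq> {..<n}" for g
    proof -
      let ?K = "(\<lambda>j. h (g j)) ` {..<r}"
      have m: "strict_mono_on {..<r} (\<lambda>j. h (g j))"
        using hmono g by (auto simp: strict_mono_on_def image_subset_iff)
      have "?K \<in> nsets H r"
        using hH g(2) strict_mono_on_imp_inj_on[OF m]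
        by (auto simp: nsets_def card_image image_subset_iff)
      then have "f ?K = i" using H(2) by blast
      moreover have "F (\<lambda>j. sorted_list_of_set ?K ! j) = F (\<lambda>j. h (g j))"
        by (rule F(2)) (simp add: sorted_list_of_set_image_strict_mono[OF m])
      ultimately have "\<beta> (F (\<lambda>j. h (g j))) = i" by (simp add: f_def)
      then show ?thesis using F(1) \<beta> by (metis bij_betw_inv_into_left)
    qed
    then show ?thesis using hmono hH H'(1) by blast
  qed
  then show ?thesis by (intro exI[of _ N] allI impI) blast
qed

text \<open>Cut \<open>k * n\<close> points of a homogeneous set into \<open>k\<close> consecutive
  blocks of length \<open>n\<close>: a choice of one point in each block is an increasing
  \<open>k\<close>-tuple.\<close>

lemma grid_ramsey:
  fixes n k :: nat
  shows "\<exists>N. \<forall>Col :: (nat \<Rightarrow> nat) \<Rightarrow> bool. (\<forall>\<eta> \<eta>'. (\<forall>i<k. \<eta> i = \<eta>' i) \<longrightarrow> Col \<eta> = Col \<eta>') \<longrightarrow>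
    (\<exists>g c. (\<forall>i<k. inj_on (g i) {..<n} \<and> g i ` {..<n} \<subseteq> {..<N}) \<and>
      (\<forall>\<eta>. (\<forall>i<k. \<eta> i < n) \<longrightarrow> Col (\<lambda>i. g i (\<eta> i)) = c))"
proof -
  have index: "i * n + j < i' * n" if "i < i'" "j < n" for i i' j
    using that mult_le_mono1[of "Suc i" i' n] by simp
  from ramsey_strict_mono[of "UNIV :: bool set" k "k * n", OF finite] obtain N
    where N: "\<forall>F :: (nat \<Rightarrow> nat) \<Rightarrow> bool. (\<forall>g. F g \<in> UNIV) \<longrightarrow>
    (\<forall>g g'. (\<forall>i<k. g i = g' i) \<longrightarrow> F g = F g') \<longrightarrow>
    (\<exists>h c. strict_mono_on {..<k * n} h \<and> h ` {..<k * n} \<subseteq> {..<N} \<and>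
      (\<forall>g. strict_mono_on {..<k} g \<longrightarrow> g ` {..<k} \<subseteq> {..<k * n} \<longrightarrow> F (\<lambda>i. h (g i)) = c))" ..
  have "\<exists>g c. (\<forall>i<k. inj_on (g i) {..<n} \<and> g i ` {..<n} \<subseteq> {..<N}) \<and>
      (\<forall>\<eta>. (\<forall>i<k. \<eta> i < n) \<longrightarrow> Col (\<lambda>i. g i (\<eta> i)) = c)"
    if Col: "\<forall>\<eta> \<eta>'. (\<forall>i<k. \<eta> i = \<eta>' i) \<longrightarrow> Col \<eta> = Col \<eta>'" for Col :: "(nat \<Rightarrow> nat) \<Rightarrow> bool"
  proof -
    obtain h c where h: "strict_mono_on {..<k * n} h" "h ` {..<k * n} \<subseteq> {..<N}"
      and c: "\<And>g. strict_mono_on {..<k} g \<Longrightarrow> g ` {..<k} \<subseteq> {..<k * n} \<Longrightarrow> Col (\<lambda>i. h (g i)) = c"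
      using N[THEN spec[of _ Col]] Col by auto
    show ?thesis
    proof (intro exI[of _ "\<lambda>i j. h (i * n + j)"] exI[of _ c] conjI allI impI)
      fix i assume i: "i < k"
      show "inj_on (\<lambda>j. h (i * n + j)) {..<n}"
      proof (rule inj_onI)
        fix x y assume "x \<in> {..<n}" "y \<in> {..<n}" "h (i * n + x) = h (i * n + y)"
        then show "x = y"
          using inj_onD[OF strict_mono_on_imp_inj_on[OF h(1)], of "i * n + x" "i * n + y"]
            index[OF i, of x] index[OF i, of y] by simp
      qed
      show "(\<lambda>j. h (i * n + j)) ` {..<n} \<subseteq> {..<N}"
        using h(2) index[OF i] by (auto simp: image_subset_iff)
    next
      fix \<eta> :: "nat \<Rightarrow> nat" assume \<eta>: "\<forall>i<k. \<eta> i < n"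
      show "Col (\<lambda>i. h (i * n + \<eta> i)) = c"
      proof (rule c)
        show "strict_mono_on {..<k} (\<lambda>i. i * n + \<eta> i)"
          using \<eta> index by (auto simp: strict_mono_on_def intro: less_le_trans[OF index])
        show "(\<lambda>i. i * n + \<eta> i) ` {..<k} \<subseteq> {..<k * n}"
          using \<eta> index by auto
      qed
    qed
  qed
  then show ?thesis by (intro exI[of _ N] allI impI)
qed

text \<open>Row \<open>i\<close> of the grid is a block \<open>H i\<close> of length \<open>2 * s\<close>; the colour \<open>F i\<close> sees only a
  window of length \<open>s\<close> in row \<open>i\<close>, and does not notice when this window is shifted.\<close>

lemma window_ramsey:
  fixes Col :: "'c set"
  assumes "finite Col"
  shows "\<exists>N. \<forall>F :: nat \<Rightarrow> (nat \<Rightarrow> nat \<Rightarrow> nat) \<Rightarrow> 'c. (\<forall>i G. F i G \<in> Col) \<longrightarrow>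
    (\<forall>i G G'. (\<forall>j<d. \<forall>p < (if j = i then s else 2 * s). G j p = G' j p) \<longrightarrow> F i G = F i G') \<longrightarrow>
    (\<exists>H. (\<forall>i<d. inj_on (H i) {..<2 * s} \<and> H i ` {..<2 * s} \<subseteq> {..<N}) \<and>
      (\<forall>i<d. \<forall>\<sigma>\<le>s. F i (H(i := \<lambda>p. H i (p + \<sigma>))) = F i H))"
proof (cases "d = 0")
  case True
  then show ?thesis by auto
next
  case False
  define t where "t = 2 * s"
  \<comment> \<open>The number of grid entries that one colour sees: \<open>d - 1\<close> full rows
    and one window.\<close>
  define r where "r = (d - 1) * t + s"
  have index: "i * t + p < i' * t" if "i < i'" "p < t" for i i' p
    using that mult_le_mono1[of "Suc i" i' t] by simp
  have dt: "d * t = r + s" using False by (cases d) (simp_all add: r_def t_def)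
  \<comment> \<open>The colours of all rows are taken together, so that one homogeneous set serves
    every row.\<close>
  let ?C = "{..<d} \<rightarrow>\<^sub>E Col"
  have "finite ?C" using assms by (simp add: finite_PiE)
  from ramsey_strict_mono[OF this, of r "d * t"] obtain N where
    N: "\<forall>F :: (nat \<Rightarrow> nat) \<Rightarrow> nat \<Rightarrow> 'c. (\<forall>g. F g \<in> ?C) \<longrightarrow>
    (\<forall>g g'. (\<forall>i<r. g i = g' i) \<longrightarrow> F g = F g') \<longrightarrow>
    (\<exists>h c. strict_mono_on {..<d * t} h \<and> h ` {..<d * t} \<subseteq> {..<N} \<and>
      (\<forall>g. strict_mono_on {..<r} g \<longrightarrow> g ` {..<r} \<subseteq> {..<d * t} \<longrightarrow> F (\<lambda>i. h (g i)) = c))" ..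
  have "\<exists>H. (\<forall>i<d. inj_on (H i) {..<2 * s} \<and> H i ` {..<2 * s} \<subseteq> {..<N}) \<and>
      (\<forall>i<d. \<forall>\<sigma>\<le>s. F i (H(i := \<lambda>p. H i (p + \<sigma>))) = F i H)"
    if F: "\<And>i G. F i G \<in> Col"
      "\<And>i G G'. (\<And>j p. j < d \<Longrightarrow> p < (if j = i then s else 2 * s) \<Longrightarrow> G j p = G' j p) \<Longrightarrow> F i G = F i G'"
    for F :: "nat \<Rightarrow> (nat \<Rightarrow> nat \<Rightarrow> nat) \<Rightarrow> 'c"
  proof -
    \<comment> \<open>An \<open>r\<close>-tuple is read as a grid; row \<open>i\<close> fills only
      \<open>s\<close> places, so the later rows start \<open>s\<close> places earlier.\<close>
    define G where "G i \<kappa> j p = (\<kappa> (if j \<le> i then j * t + p else j * t + p - s) :: nat)"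
      for i j p :: nat and \<kappa> :: "nat \<Rightarrow> nat"
    define F' where "F' \<kappa> = restrict (\<lambda>i. F i (G i \<kappa>)) {..<d}" for \<kappa>
    have pos: "(if j \<le> i then j * t + p else j * t + p - s) < r"
      if "i < d" "j < d" "p < (if j = i then s else 2 * s)" for i j p
    proof -
      consider "j < i" | "j = i" | "j > i" by linarith
      then show ?thesis
      proof cases
        case 1
        then have "j * t + p < i * t" using index that by (auto simp: t_def)
        also have "i * t \<le> (d - 1) * t" using that(1) by (intro mult_le_mono1) auto
        finally show ?thesis using 1 by (simp add: r_def)
      next
        case 2
        have "i * t \<le> (d - 1) * t" using that(1) by (intro mult_le_mono1) auto
        then have "i * t + p < (d - 1) * t + s"
          by (rule add_le_less_mono) (use 2 that(3) in simp)
        then show ?thesis using 2 by (simp add: r_def)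
      next
        case 3
        have "j * t + p < d * t" using index that 3 by (auto simp: t_def)
        moreover have "t \<le> j * t" using 3 by simp
        then have "s \<le> j * t" unfolding t_def by linarith
        ultimately show ?thesis using 3 dt by simp
      qed
    qed
    have dep: "F' \<kappa> = F' \<kappa>'" if "\<forall>i<r. \<kappa> i = \<kappa>' i" for \<kappa> \<kappa>'
    proof -
      have "F i (G i \<kappa>) = F i (G i \<kappa>')" if i: "i < d" for i
      proof (rule F(2))
        fix j p assume "j < d" "p < (if j = i then s else 2 * s)"
        from pos[OF i this] show "G i \<kappa> j p = G i \<kappa>' j p"
          using \<open>\<forall>i<r. \<kappa> i = \<kappa>' i\<close> by (simp add: G_def)
      qed
      then show ?thesis by (auto simp: F'_def)
    qed
    have "\<forall>\<kappa>. F' \<kappa> \<in> ?C" using F(1) by (auto simp: F'_def)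
    then obtain h c where h: "strict_mono_on {..<d * t} h" "h ` {..<d * t} \<subseteq> {..<N}"
      and c: "\<And>g. strict_mono_on {..<r} g \<Longrightarrow> g ` {..<r} \<subseteq> {..<d * t} \<Longrightarrow> F' (\<lambda>i. h (g i)) = c"
      using N[THEN spec[of _ F']] dep by auto
    define H where "H i p = h (i * t + p)" for i p
    have shift: "F i (H(i := \<lambda>p. H i (p + \<sigma>))) = c i" if i: "i < d" and \<sigma>: "\<sigma> \<le> s" for i \<sigma>
    proof -
      \<comment> \<open>Skips \<open>\<sigma>\<close> points before the window of row
        \<open>i\<close> and \<open>s - \<sigma>\<close> after it. Every shift thus reads an
        increasing \<open>r\<close>-tuple from the same homogeneous set.\<close>
      define g where "g p = (if p < i * t then p else if p < i * t + s then p + \<sigma> else p + s)" for p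
      have "F' (\<lambda>i. h (g i)) = c"
      proof (rule c)
        show "strict_mono_on {..<r} g" using \<sigma> by (auto simp: strict_mono_on_def g_def)
        show "g ` {..<r} \<subseteq> {..<d * t}" using \<sigma> unfolding dt by (auto simp: g_def)
      qed
      then have "F i (G i (\<lambda>i. h (g i))) = c i" using i by (metis F'_def lessThan_iff restrict_apply')
      moreover have "F i (G i (\<lambda>i. h (g i))) = F i (H(i := \<lambda>p. H i (p + \<sigma>)))"
      proof (rule F(2))
        fix j p assume j: "j < d" and p: "p < (if j = i then s else 2 * s)"
        consider "j < i" | "j = i" | "j > i" by linarith
        then show "G i (\<lambda>i. h (g i)) j p = (H(i := \<lambda>p. H i (p + \<sigma>))) j p"
        proof cases
          case 1
          then have "j * t + p < i * t" using index p by (auto simp: t_def)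
          then show ?thesis using 1 by (simp add: G_def g_def H_def)
        next
          case 2
          then show ?thesis using p by (simp add: G_def g_def H_def add.assoc)
        next
          case 3
          have "Suc i * t \<le> j * t" using 3 by (intro mult_le_mono1) auto
          then have "i * t + s \<le> j * t + p - s" by (simp add: t_def)
          moreover have "t \<le> j * t" using 3 by simp
          then have "s \<le> j * t" unfolding t_def by linarith
          ultimately show ?thesis using 3 by (simp add: G_def g_def H_def)
        qed
      qed
      ultimately show ?thesis by simp
    qed
    have "inj_on (H i) {..<2 * s} \<and> H i ` {..<2 * s} \<subseteq> {..<N}" if i: "i < d" for i
    proof
      show "inj_on (H i) {..<2 * s}"
      proof (rule inj_onI)
        fix x y assume "x \<in> {..<2 * s}" "y \<in> {..<2 * s}" "H i x = H i y"
        then show "x = y"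
          using inj_onD[OF strict_mono_on_imp_inj_on[OF h(1)], of "i * t + x" "i * t + y"]
            index[OF i, of x] index[OF i, of y] by (simp add: H_def t_def)
      qed
      show "H i ` {..<2 * s} \<subseteq> {..<N}"
        using h(2) index[OF i] by (auto simp: H_def t_def image_subset_iff)
    qed
    moreover have "F i (H(i := \<lambda>p. H i (p + \<sigma>))) = F i H" if "i < d" "\<sigma> \<le> s" for i \<sigma>
      using shift[of i \<sigma>] shift[of i 0] that by simp
    ultimately show ?thesis by blast
  qed
  note * = this
  show ?thesis by (intro exI[of _ N] allI impI *) blast+
qed

section \<open>Patterns\<close>

lemma uniform_bound:
  fixes P :: "'b \<Rightarrow> nat \<Rightarrow> bool"
  assumes "finite S" "\<And>s. s \<in> S \<Longrightarrow> \<exists>m. P s m" "\<And>s m n. P s m \<Longrightarrow> m \<le> n \<Longrightarrow> P s n"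
  shows "\<exists>m. \<forall>s\<in>S. P s m"
  using assms(1,2)
proof (induction S)
  case (insert s S)
  then obtain m n where "\<forall>s\<in>S. P s m" "P s n" by blast
  then have "\<forall>t\<in>insert s S. P t (max m n)" 
    using assms(3)[of _ m "max m n"] assms(3)[of _ n "max m n"] by auto
  then show ?case by blast
qed simp

lemma definable_pred_subst2:
  assumes "definable_pred M (\<lambda>e. \<Phi> (\<lambda>n. e (Inl n)) (\<lambda>n. e (Inr n)))"
    and "\<And>i. (\<exists>j. \<forall>e. \<tau> e i = e j) \<or> (\<exists>c. \<forall>e. \<tau> e i = c)"
    and "\<And>i. (\<exists>j. \<forall>e. \<rho> e i = e j) \<or> (\<exists>c. \<forall>e. \<rho> e i = c)"
  shows "definable_pred M (\<lambda>e. \<Phi> (\<tau> e) (\<rho> e))"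
proof -
  have "(\<exists>j. \<forall>e. case_sum (\<tau> e) (\<rho> e) i = e j) \<or> (\<exists>c. \<forall>e. case_sum (\<tau> e) (\<rho> e) i = c)" for i
    using assms(2,3) by (cases i) simp_all
  from definable_pred_subst[OF assms(1), of "\<lambda>e. case_sum (\<tau> e) (\<rho> e)", OF this] show ?thesis by simp
qed

text \<open>Patterns of finite width, so that they can be thinned out by finite Ramsey arguments.\<close>

definition pattern :: "nat set \<Rightarrow> nat \<Rightarrow> ((nat \<Rightarrow> 'a) \<Rightarrow> bool) \<Rightarrow> (nat \<Rightarrow> (nat \<Rightarrow> 'a) \<Rightarrow> (nat \<Rightarrow> 'a) \<Rightarrow> bool) \<Rightarrow> bool"
  where "pattern R N D \<Phi> \<longleftrightarrow> (\<exists>b. \<forall>\<eta>. (\<forall>i\<in>R. \<eta> i < N) \<longrightarrow>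
    (\<exists>a. D a \<and> (\<forall>i\<in>R. \<forall>j<N. \<Phi> i a (b i j) \<longleftrightarrow> j = \<eta> i)))"

lemma pattern_mono:
  assumes "pattern R N D \<Phi>" "N' \<le> N" "\<And>a. D a \<Longrightarrow> D' a"
  shows "pattern R N' D' \<Phi>"
proof -
  obtain b where b: "\<And>\<eta>. (\<forall>i\<in>R. \<eta> i < N) \<Longrightarrow> \<exists>a. D a \<and> (\<forall>i\<in>R. \<forall>j<N. \<Phi> i a (b i j) \<longleftrightarrow> j = \<eta> i)"
    using assms(1) unfolding pattern_def by blast
  show ?thesis unfolding pattern_def
  proof (intro exI[of _ b] allI impI)
    fix \<eta> assume "\<forall>i\<in>R. \<eta> i < N'"
    then have "\<forall>i\<in>R. \<eta> i < N" using assms(2) by auto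
    from b[OF this] show "\<exists>a. D' a \<and> (\<forall>i\<in>R. \<forall>j<N'. \<Phi> i a (b i j) \<longleftrightarrow> j = \<eta> i)"
      using assms(2,3) by (metis less_le_trans)
  qed
qed

text \<open>Closed (\<open>k\<close> true) and open balls in one family, so that finitely many of
  them can be indexed uniformly. Radius element \<open>r = 0\<close> gives a point or the empty
  set.\<close>

definition gen_ball :: "('a::field \<Rightarrow> 'g::linordered_ab_group_add extended) \<Rightarrow> bool \<Rightarrow> 'a \<Rightarrow> 'a \<Rightarrow> 'a set"
  where "gen_ball v k c r = {x. if k then v r \<le> v (x - c) else v r < v (x - c)}"

lemma same_iff_gen_ball: "same v c r x y \<longleftrightarrow> (\<forall>k. x \<in> gen_ball v k c r \<longleftrightarrow> y \<in> gen_ball v k c r)"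
  by (simp add: same_def gen_ball_def all_bool_eq)

context C_minimal_monster
begin

lemma gen_ball_recentre:
  assumes "x \<in> gen_ball v k c r" shows "gen_ball v k c r = gen_ball v k x r"
proof -
  have "v r \<le> v (y - c) \<longleftrightarrow> v r \<le> v (y - x)" if "v r \<le> v (x - c)" for y
    using v_diff_ge_trans[of "v r" y x c] v_diff_ge_trans[of "v r" y c x] that
    by (auto simp: v_diff_commute[of c x])
  moreover have "v r < v (y - c) \<longleftrightarrow> v r < v (y - x)" if "v r < v (x - c)" for y
    using v_diff_gt_trans[of "v r" y x c] v_diff_gt_trans[of "v r" y c x] that
    by (auto simp: v_diff_commute[of c x])
  ultimately show ?thesis using assms by (auto simp: gen_ball_def)
qed

text \<open>Once recentred at the common point, two balls differ only in radius and type.\<close>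

lemma gen_ball_chain:
  assumes "x \<in> gen_ball v k c r" "x \<in> gen_ball v k' c' r'"
  shows "gen_ball v k c r \<subseteq> gen_ball v k' c' r' \<or> gen_ball v k' c' r' \<subseteq> gen_ball v k c r"
proof -
  have "gen_ball v k x r \<subseteq> gen_ball v k' x r' \<or> gen_ball v k' x r' \<subseteq> gen_ball v k x r"
  proof (cases "v r" "v r'" rule: linorder_cases)
    case less
    then have "gen_ball v k' x r' \<subseteq> gen_ball v k x r" by (auto simp: gen_ball_def)
    then show ?thesis ..
  next
    case equal
    then show ?thesis by (cases k; cases k') (auto simp: gen_ball_def)
  next
    case greater
    then have "gen_ball v k x r \<subseteq> gen_ball v k' x r'" by (auto simp: gen_ball_def)
    then show ?thesis ..
  qed
  then show ?thesis using gen_ball_recentre[OF assms(1)] gen_ball_recentre[OF assms(2)] by simp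
qed

text \<open>The membership of \<open>x\<close> in the fibres with parameters \<open>W\<close> is decided by balls which do not
  depend on row \<open>i\<^sub>0\<close>. If every row \<open>i\<^sub>0\<close> had such a ball around \<open>x\<close> that is lost when the window
  in some other row \<open>i\<^sub>1\<close> is shifted, then the largest of all these balls would contain one that
  does not depend on \<open>i\<^sub>1\<close>; by homogeneity the shifted ball would contain it as well, hence \<open>x\<close>.\<close>

lemma pattern_fix_coordinate:
  assumes D: "definable_pred M D"
    and \<Phi>: "\<And>i. i \<in> R \<Longrightarrow> definable_pred M (\<lambda>e. \<Phi> i (\<lambda>n. e (Inl n)) (\<lambda>n. e (Inr n)))"
    and R: "finite R" "R \<noteq> {}" and C: "finite C" and s: "0 < s"
  shows "\<exists>N. \<forall>u. pattern R N (\<lambda>a. D a \<and> (\<forall>c\<in>C. a c = u c)) \<Phi> \<longrightarrow>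
    (\<exists>x. \<exists>i0\<in>R. pattern (R - {i0}) s (\<lambda>a. D a \<and> (\<forall>c\<in>C. a c = u c) \<and> a c0 = x) \<Phi>)"
proof -
  obtain d where d: "R \<subseteq> {..<d}" using R(1) finite_nat_iff_bounded by blast
  \<comment> \<open>The possible values of coordinate \<open>c0\<close> along the path
    \<open>e0\<close>, with row \<open>i0\<close> ignored: these are the one-variable sets to which
    the coding by balls applies.\<close>
  define \<Theta> where "\<Theta> u i0 e0 W x \<longleftrightarrow> (\<exists>a. D a \<and> (\<forall>c\<in>C. a c = u c) \<and> a c0 = x \<and>
      (\<forall>i\<in>R - {i0}. \<forall>p<s. \<Phi> i a (W i p) \<longleftrightarrow> p = e0 i))"
    for u i0 e0 W x
  define EE where "EE = R \<rightarrow>\<^sub>E {..<s}"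
  have fEE: "finite EE" unfolding EE_def by (intro finite_PiE R(1)) simp
  have "\<exists>m. \<forall>u W. coded v m {x. \<Theta> u i0 e0 W x}" for i0 e0
  proof -
    define P where "P E \<longleftrightarrow> \<Theta> (\<lambda>c. E (Inr (Inl c))) i0 e0 (\<lambda>i p n. E (Inr (Inr (i, p, n)))) (E (Inl ()))"
      for E :: "unit + nat + nat \<times> nat \<times> nat \<Rightarrow> 'a"
    have "definable_pred M P"
      unfolding P_def \<Theta>_def
      by (intro definable_pred_intros definable_pred_finite_ball C R(1) finite_Diff definable_pred_subst[OF D] definable_pred_subst2[OF \<Phi>]) auto
    from coded_uniform[OF this, of "Inl ()"] obtain m where m: "\<And>E. coded v m {x. P (E(Inl () := x))}"
      by blast
    have "coded v m {x. \<Theta> u i0 e0 W x}" for u W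
      using m[of "\<lambda>k. case k of Inl _ \<Rightarrow> 0 | Inr (Inl c) \<Rightarrow> u c | Inr (Inr (i, p, n)) \<Rightarrow> W i p n"]
      by (simp add: P_def)
    then show ?thesis by blast
  qed
  then have "\<exists>m. \<forall>u W. coded v m {x. \<Theta> u (fst q) (snd q) W x}" for q by blast
  from uniform_bound[of "R \<times> EE" "\<lambda>q m. \<forall>u W. coded v m {x. \<Theta> u (fst q) (snd q) W x}", OF _ this]
  obtain m where m: "\<And>i0 e0 u W. i0 \<in> R \<Longrightarrow> e0 \<in> EE \<Longrightarrow> coded v m {x. \<Theta> u i0 e0 W x}"
    using R(1) fEE coded_mono by fastforce
  \<comment> \<open>Names of balls: the omitted row, the path, one of the \<open>m\<close> pairs,
    and closed or open.\<close>
  define QQ where "QQ = R \<times> EE \<times> {..<m} \<times> (UNIV :: bool set)"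
  define SH where "SH = {..<d} \<rightarrow>\<^sub>E {..s}"
  define LL where "LL = {..<m} \<times> (UNIV :: bool set)"
  have fSH: "finite SH" unfolding SH_def by (intro finite_PiE) simp_all
  have fQQ: "finite QQ" using R(1) fEE by (simp add: QQ_def)
  let ?Col = "Pow (QQ \<times> QQ \<times> SH \<times> SH) \<times> Pow (R \<times> EE \<times> SH \<times> Pow LL)"
  have "finite ?Col" using fSH fQQ R(1) fEE by (simp add: LL_def)
  from window_ramsey[OF this, of d s] obtain N where N:
    "\<forall>F :: nat \<Rightarrow> (nat \<Rightarrow> nat \<Rightarrow> nat) \<Rightarrow> _. (\<forall>i G. F i G \<in> ?Col) \<longrightarrow>
    (\<forall>i G G'. (\<forall>j<d. \<forall>p < (if j = i then s else 2 * s). G j p = G' j p) \<longrightarrow> F i G = F i G') \<longrightarrow>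
    (\<exists>H. (\<forall>i<d. inj_on (H i) {..<2 * s} \<and> H i ` {..<2 * s} \<subseteq> {..<N}) \<and>
      (\<forall>i<d. \<forall>\<sigma>\<le>s. F i (H(i := \<lambda>p. H i (p + \<sigma>))) = F i H))" ..
  have main: "\<exists>x. \<exists>i0\<in>R. pattern (R - {i0}) s (\<lambda>a. D a \<and> (\<forall>c\<in>C. a c = u c) \<and> a c0 = x) \<Phi>"
    if "pattern R N (\<lambda>a. D a \<and> (\<forall>c\<in>C. a c = u c)) \<Phi>" for u
  proof -
    from that obtain b where b: "\<forall>\<eta>. (\<forall>i\<in>R. \<eta> i < N) \<longrightarrow>
        (\<exists>a. (D a \<and> (\<forall>c\<in>C. a c = u c)) \<and> (\<forall>i\<in>R. \<forall>j<N. \<Phi> i a (b i j) \<longleftrightarrow> j = \<eta> i))"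
      unfolding pattern_def ..
    have "\<forall>q W. \<exists>c r. fst q \<in> R \<longrightarrow> snd q \<in> EE \<longrightarrow> (\<forall>x y. (\<forall>l<m. same v (c l) (r l) x y) \<longrightarrow>
        (\<Theta> u (fst q) (snd q) W x \<longleftrightarrow> \<Theta> u (fst q) (snd q) W y))"
      using m unfolding coded_def mem_Collect_eq by blast
    then obtain cc rr where cr: "\<And>q W x y. fst q \<in> R \<Longrightarrow> snd q \<in> EE \<Longrightarrow> \<forall>l<m. same v (cc q W l) (rr q W l) x y \<Longrightarrow>
        (\<Theta> u (fst q) (snd q) W x \<longleftrightarrow> \<Theta> u (fst q) (snd q) W y)"
      by metis
    define bl where "bl q W = (case q of (i0, e0, l, k) \<Rightarrow> gen_ball v k (cc (i0, e0) W l) (rr (i0, e0) W l))" for q W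
    define mem where "mem i0 e0 W y = {lk \<in> LL. y \<in> bl (i0, e0, fst lk, snd lk) W}" for i0 e0 W y
    have mem_eq: "\<Theta> u i0 e0 W x \<longleftrightarrow> \<Theta> u i0 e0 W y"
      if "i0 \<in> R" "e0 \<in> EE" "mem i0 e0 W x = mem i0 e0 W y" for i0 e0 W x y
    proof -
      have "\<forall>l<m. same v (cc (i0, e0) W l) (rr (i0, e0) W l) x y"
        unfolding same_iff_gen_ball
      proof (intro allI impI)
        fix l k assume "l < m"
        then have "(l, k) \<in> LL" by (simp add: LL_def)
        with that(3) show "x \<in> gen_ball v k (cc (i0, e0) W l) (rr (i0, e0) W l) \<longleftrightarrow>
            y \<in> gen_ball v k (cc (i0, e0) W l) (rr (i0, e0) W l)"
          unfolding mem_def bl_def by (auto simp: set_eq_iff)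
      qed
      then show ?thesis using cr[of "(i0, e0)" W x y] that(1,2) by simp
    qed
    \<comment> \<open>The window of row \<open>i\<close> starts at position \<open>sh i\<close>.
      Zeros in row \<open>i0\<close> and outside the window make the parameters, and with them the
      chosen balls, independent of the entries there.\<close>
    define Wf where "Wf i0 G sh i p = (if i \<in> R - {i0} \<and> p < s then b i (G i (sh i + p)) else (\<lambda>_. 0))"
      for i0 :: nat and G sh :: "nat \<Rightarrow> _" and i p :: nat
    \<comment> \<open>The colour records which balls omitting row \<open>i1\<close> lie inside which
      others, and which membership patterns occur in the sets \<open>\<Theta>\<close>. Where row
      \<open>i1\<close> enters, its window stands at 0, so only its first \<open>s\<close> entries
      are seen.\<close>
    define F where "F i1 G =
      ({(q, q', sh, sh') \<in> QQ \<times> QQ \<times> SH \<times> SH. fst q' = i1 \<and> bl q' (Wf i1 G sh') \<subseteq> bl q (Wf (fst q) G (sh(i1 := 0)))},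
       {(i0, e0, sh, S) \<in> R \<times> EE \<times> SH \<times> Pow LL. i0 \<noteq> i1 \<and>
         (\<exists>y. S = mem i0 e0 (Wf i0 G (sh(i1 := 0))) y \<and> \<Theta> u i0 e0 (Wf i0 G (sh(i1 := 0))) y)})"
      for i1 G
    have SH: "sh i \<le> s" if "sh \<in> SH" "i \<in> R" for sh i using that d by (auto simp: SH_def PiE_def Pi_def)
    have F1: "\<forall>i G. F i G \<in> ?Col" unfolding F_def by auto
    have F2: "F i1 G = F i1 G'"
      if G: "\<forall>j<d. \<forall>p < (if j = i1 then s else 2 * s). G j p = G' j p" for i1 G G'
    proof -
      have W: "Wf i0 G sh = Wf i0 G' sh"
        if "\<And>i. i \<in> R \<Longrightarrow> sh i \<le> s" "i0 = i1 \<or> sh i1 = 0" for i0 sh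
      proof -
        have "b i (G i (sh i + p)) = b i (G' i (sh i + p))" if "i \<in> R - {i0}" "p < s" for i p
        proof -
          have "sh i + p < (if i = i1 then s else 2 * s)"
            using that \<open>i0 = i1 \<or> sh i1 = 0\<close> \<open>\<And>i. i \<in> R \<Longrightarrow> sh i \<le> s\<close>[of i] by auto
          then show ?thesis using G that(1) d by auto
        qed
        then show ?thesis unfolding Wf_def by (intro ext) simp
      qed
      have "Wf i1 G sh = Wf i1 G' sh" if "sh \<in> SH" for sh
        by (rule W) (use SH[OF that] in auto)
      moreover have "Wf i0 G (sh(i1 := 0)) = Wf i0 G' (sh(i1 := 0))" if "sh \<in> SH" for i0 sh
        by (rule W) (use SH[OF that] in auto)
      ultimately show ?thesis unfolding F_def by (auto simp del: fun_upd_apply)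
    qed
    have "\<forall>i G G'. (\<forall>j<d. \<forall>p < (if j = i then s else 2 * s). G j p = G' j p) \<longrightarrow> F i G = F i G'"
      using F2 by blast
    from N[THEN spec[of _ F], THEN mp, OF F1, THEN mp, OF this] obtain H
      where H0: "\<forall>i<d. inj_on (H i) {..<2 * s} \<and> H i ` {..<2 * s} \<subseteq> {..<N}"
        "\<forall>i<d. \<forall>\<sigma>\<le>s. F i (H(i := \<lambda>p. H i (p + \<sigma>))) = F i H"
      by (elim exE conjE)
    have H: "inj_on (H i) {..<2 * s}" "H i ` {..<2 * s} \<subseteq> {..<N}"
      "\<sigma> \<le> s \<Longrightarrow> F i (H(i := \<lambda>p. H i (p + \<sigma>))) = F i H" if "i < d" for i \<sigma>
      using H0 that by auto
    have W1: "Wf i1 (H(i1 := h)) sh = Wf i1 H sh" for i1 h sh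
      unfolding Wf_def by (intro ext) auto
    have W2: "Wf i0 (H(i1 := \<lambda>p. H i1 (p + \<sigma>))) (sh(i1 := 0)) = Wf i0 H (sh(i1 := \<sigma>))" for i0 i1 \<sigma> sh
      unfolding Wf_def by (intro ext) (auto simp: add.commute)
    have HA: "bl q' (Wf i1 H sh') \<subseteq> bl q (Wf (fst q) H (sh(i1 := \<sigma>))) \<longleftrightarrow>
        bl q' (Wf i1 H sh') \<subseteq> bl q (Wf (fst q) H (sh(i1 := 0)))"
      if "q \<in> QQ" "q' \<in> QQ" "fst q' = i1" "sh \<in> SH" "sh' \<in> SH" "\<sigma> \<le> s" "i1 < d" for q q' i1 sh sh' \<sigma>
    proof -
      have "(q, q', sh, sh') \<in> fst (F i1 (H(i1 := \<lambda>p. H i1 (p + \<sigma>)))) \<longleftrightarrow> (q, q', sh, sh') \<in> fst (F i1 H)"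
        using H(3)[of i1 \<sigma>] that by simp
      then show ?thesis using that unfolding F_def by (simp add: W1 W2 del: fun_upd_apply)
    qed
    have HB: "(\<exists>y. S = mem i0 e0 (Wf i0 H (sh(i1 := \<sigma>))) y \<and> \<Theta> u i0 e0 (Wf i0 H (sh(i1 := \<sigma>))) y) \<longleftrightarrow>
        (\<exists>y. S = mem i0 e0 (Wf i0 H (sh(i1 := 0))) y \<and> \<Theta> u i0 e0 (Wf i0 H (sh(i1 := 0))) y)"
      if "i0 \<in> R" "i1 \<noteq> i0" "e0 \<in> EE" "sh \<in> SH" "\<sigma> \<le> s" "i1 < d" "S \<subseteq> LL" for i0 i1 e0 sh \<sigma> S
    proof -
      have "(i0, e0, sh, S) \<in> snd (F i1 (H(i1 := \<lambda>p. H i1 (p + \<sigma>)))) \<longleftrightarrow> (i0, e0, sh, S) \<in> snd (F i1 H)"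
        using H(3)[of i1 \<sigma>] that by simp
      then show ?thesis using that unfolding F_def by (simp add: W2 del: fun_upd_apply)
    qed
    \<comment> \<open>The path runs through position \<open>s\<close> of every block. A window
      starting at \<open>s - e0 i\<close> meets it at index \<open>e0 i\<close>, so one point serves
      all paths \<open>e0\<close>.\<close>
    have Hs: "\<forall>i\<in>R. H i s < N" using H(2) d s by (auto simp: image_subset_iff subset_iff)
    obtain a0 where a0: "D a0" "\<forall>c\<in>C. a0 c = u c" "\<And>i j. i \<in> R \<Longrightarrow> j < N \<Longrightarrow> \<Phi> i a0 (b i j) \<longleftrightarrow> j = H i s"
      using b[THEN spec, THEN mp, OF Hs] by blast
    define x where "x = a0 c0"
    have start: "\<Theta> u i0 e0 (Wf i0 H (restrict (\<lambda>i. s - e0 i) {..<d})) x" if "e0 \<in> EE" for i0 e0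
      unfolding \<Theta>_def
    proof (intro exI[of _ a0] conjI ballI allI impI a0(1))
      fix i p assume i: "i \<in> R - {i0}" and p: "p < s"
      then have e: "e0 i < s" "i < d" using that d by (auto simp: EE_def PiE_def Pi_def)
      have "H i (s - e0 i + p) < N" using H(2)[OF e(2)] p by (auto simp: image_subset_iff)
      moreover have "H i (s - e0 i + p) = H i s \<longleftrightarrow> s - e0 i + p = s"
        by (rule inj_on_eq_iff[OF H(1)[OF e(2)]]) (use p e s in auto)
      ultimately show "\<Phi> i a0 (Wf i0 H (restrict (\<lambda>i. s - e0 i) {..<d}) i p) \<longleftrightarrow> p = e0 i"
        using i p e a0(3)[of i "H i (s - e0 i + p)"] by (auto simp: Wf_def)
    qed (use a0 in \<open>auto simp: x_def\<close>)
    have "\<exists>i0\<in>R. \<forall>q\<in>QQ. \<forall>sh\<in>SH. \<forall>i1\<in>R - {i0}. \<forall>\<sigma>\<le>s. fst q = i0 \<longrightarrow>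
        x \<in> bl q (Wf i0 H sh) \<longrightarrow> x \<in> bl q (Wf i0 H (sh(i1 := \<sigma>)))"
    proof (rule ccontr)
      assume neg: "\<not> ?thesis"
      define BB where "BB = {bl q (Wf (fst q) H sh) | q sh. q \<in> QQ \<and> sh \<in> SH \<and>
        x \<in> bl q (Wf (fst q) H sh) \<and> (\<exists>i1\<in>R - {fst q}. \<exists>\<sigma>\<le>s. x \<notin> bl q (Wf (fst q) H (sh(i1 := \<sigma>))))}"
      have "BB \<subseteq> (\<lambda>(q, sh). bl q (Wf (fst q) H sh)) ` (QQ \<times> SH)"
      proof
        fix X assume "X \<in> BB"
        then obtain q sh where "q \<in> QQ" "sh \<in> SH" "X = bl q (Wf (fst q) H sh)"
          unfolding BB_def by blast
        then show "X \<in> (\<lambda>(q, sh). bl q (Wf (fst q) H sh)) ` (QQ \<times> SH)"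
          by (intro image_eqI[of _ _ "(q, sh)"]) simp_all
      qed
      then have "finite BB" using fQQ fSH by (meson finite_SigmaI finite_imageI finite_subset)
      moreover have broken: "\<exists>q sh. fst q = i0 \<and> q \<in> QQ \<and> sh \<in> SH \<and> x \<in> bl q (Wf i0 H sh) \<and>
          bl q (Wf i0 H sh) \<in> BB" if i0: "i0 \<in> R" for i0
      proof -
        obtain q sh i1 \<sigma> where "q \<in> QQ" "sh \<in> SH" "i1 \<in> R - {i0}" "\<sigma> \<le> s" "fst q = i0"
          "x \<in> bl q (Wf i0 H sh)" "x \<notin> bl q (Wf i0 H (sh(i1 := \<sigma>)))"
          using neg i0 by blast
        then show ?thesis unfolding BB_def by blast
      qed
      then have "BB \<noteq> {}" using R(2) by blast
      ultimately obtain X where X: "X \<in> BB" "\<And>Y. Y \<in> BB \<Longrightarrow> X \<subseteq> Y \<Longrightarrow> X = Y"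
        using finite_has_maximal[of BB] by metis
      then obtain q sh i1 \<sigma> where q: "X = bl q (Wf (fst q) H sh)" "q \<in> QQ" "sh \<in> SH"
        "x \<in> bl q (Wf (fst q) H sh)" "i1 \<in> R - {fst q}" "\<sigma> \<le> s" "x \<notin> bl q (Wf (fst q) H (sh(i1 := \<sigma>)))"
        unfolding BB_def by blast
      obtain q' sh' where q': "fst q' = i1" "q' \<in> QQ" "sh' \<in> SH" "x \<in> bl q' (Wf i1 H sh')"
        "bl q' (Wf i1 H sh') \<in> BB"
        using broken[of i1] q(5) by blast
      have "bl q' (Wf i1 H sh') \<subseteq> X \<or> X \<subseteq> bl q' (Wf i1 H sh')"
        using q(4) q'(4) unfolding q(1) bl_def by (auto split: prod.splits dest: gen_ball_chain)
      \<comment> \<open>Since \<open>X\<close> is maximal among the broken balls, the ball that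
        omits row \<open>i1\<close> is the inner one.\<close>
      then have sub: "bl q' (Wf i1 H sh') \<subseteq> bl q (Wf (fst q) H sh)"
        using X(2)[OF q'(5)] unfolding q(1) by blast
      have i1: "i1 < d" "sh i1 \<le> s" using q(5) d SH[OF q(3)] by auto
      \<comment> \<open>The actual shift \<open>sh i1\<close> and the new shift
        \<open>\<sigma>\<close> are both compared with shift 0.\<close>
      have "bl q' (Wf i1 H sh') \<subseteq> bl q (Wf (fst q) H (sh(i1 := \<sigma>)))"
        using HA[OF q(2) q'(2,1) q(3) q'(3) q(6) i1(1)] HA[OF q(2) q'(2,1) q(3) q'(3) i1(2,1)] sub by simp
      then show False using q'(4) q(7) by blast
    qed
    then obtain i0 where i0: "i0 \<in> R" and unbroken: "\<And>q sh i1 \<sigma>. q \<in> QQ \<Longrightarrow> sh \<in> SH \<Longrightarrow>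
        i1 \<in> R - {i0} \<Longrightarrow> \<sigma> \<le> s \<Longrightarrow> fst q = i0 \<Longrightarrow> x \<in> bl q (Wf i0 H sh) \<Longrightarrow> x \<in> bl q (Wf i0 H (sh(i1 := \<sigma>)))"
      by blast
    have upd_SH: "sh(i1 := \<sigma>) \<in> SH" if "sh \<in> SH" "i1 \<in> R" "\<sigma> \<le> s" for sh i1 \<sigma>
      using that d by (auto simp: SH_def PiE_def extensional_def)
    have step: "\<Theta> u i0 e0 (Wf i0 H (sh(i1 := \<sigma>))) x"
      if "\<Theta> u i0 e0 (Wf i0 H sh) x" "e0 \<in> EE" "sh \<in> SH" "i1 \<in> R - {i0}" "\<sigma> \<le> s" for e0 sh i1 \<sigma>
    proof -
      let ?sh = "sh(i1 := \<sigma>)"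
      have i1: "i1 < d" "sh i1 \<le> s" "i1 \<in> R" "i1 \<noteq> i0" using that d SH[OF that(3)] by auto
      have Q: "(i0, e0, fst lk, snd lk) \<in> QQ" if "lk \<in> LL" for lk
        using that \<open>e0 \<in> EE\<close> i0 by (auto simp: QQ_def LL_def)
      \<comment> \<open>The choice of \<open>i0\<close> only says that \<open>x\<close> is not lost
        under a shift; the converse follows by shifting back to \<open>sh i1\<close>.\<close>
      have mm: "mem i0 e0 (Wf i0 H sh) x = mem i0 e0 (Wf i0 H ?sh) x"
      proof -
        have "x \<in> bl (i0, e0, fst lk, snd lk) (Wf i0 H sh) \<longleftrightarrow> x \<in> bl (i0, e0, fst lk, snd lk) (Wf i0 H ?sh)"
          if lk: "lk \<in> LL" for lk
        proof
          show "x \<in> bl (i0, e0, fst lk, snd lk) (Wf i0 H ?sh)" if "x \<in> bl (i0, e0, fst lk, snd lk) (Wf i0 H sh)"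
            using unbroken[OF Q[OF lk] \<open>sh \<in> SH\<close> \<open>i1 \<in> R - {i0}\<close> \<open>\<sigma> \<le> s\<close> _ that] by simp
          show "x \<in> bl (i0, e0, fst lk, snd lk) (Wf i0 H sh)" if "x \<in> bl (i0, e0, fst lk, snd lk) (Wf i0 H ?sh)"
            using unbroken[OF Q[OF lk] upd_SH[OF \<open>sh \<in> SH\<close> i1(3) \<open>\<sigma> \<le> s\<close>] \<open>i1 \<in> R - {i0}\<close> i1(2) _ that] by simp
        qed
        then show ?thesis unfolding mem_def by blast
      qed
      have S: "mem i0 e0 (Wf i0 H sh) x \<subseteq> LL" unfolding mem_def by blast
      \<comment> \<open>Homogeneity gives some \<open>y\<close> in the shifted set with the
        membership pattern of \<open>x\<close>; as the shifted balls decide that set,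
        \<open>x\<close> belongs to it as well.\<close>
      have "\<exists>y. mem i0 e0 (Wf i0 H sh) x = mem i0 e0 (Wf i0 H ?sh) y \<and> \<Theta> u i0 e0 (Wf i0 H ?sh) y"
        using HB[OF i0 i1(4) that(2,3,5) i1(1) S] HB[OF i0 i1(4) that(2,3) i1(2,1) S] that(1) by auto
      then show ?thesis using mem_eq[OF i0 that(2)] mm by metis
    qed
    have fin: "\<Theta> u i0 e0 (Wf i0 H (\<lambda>_. s)) x" if e0: "e0 \<in> EE" for e0
    proof -
      \<comment> \<open>The windows start at \<open>s - e0 i\<close> and are moved, one row at a
        time, to the common position \<open>s\<close>, which does not depend on
        \<open>e0\<close>.\<close>
      define sh where "sh = restrict (\<lambda>i. s - e0 i) {..<d}"
      have sh: "sh \<in> SH" by (auto simp: sh_def SH_def)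
      have "(\<lambda>i. if i \<in> Q then s else sh i) \<in> SH \<and> \<Theta> u i0 e0 (Wf i0 H (\<lambda>i. if i \<in> Q then s else sh i)) x"
        if "finite Q" "Q \<subseteq> R - {i0}" for Q
        using that
      proof (induction Q)
        case empty
        show ?case using sh start[OF e0, of i0, folded sh_def] by simp
      next
        case (insert i Q)
        have *: "(\<lambda>j. if j \<in> insert i Q then s else sh j) = (\<lambda>j. if j \<in> Q then s else sh j)(i := s)"
          by auto
        show ?case unfolding *
          using insert.IH insert.prems step[OF _ e0, of _ i s] upd_SH[of _ i s] by auto
      qed
      from this[of "R - {i0}"] R(1)
      have "\<Theta> u i0 e0 (Wf i0 H (\<lambda>i. if i \<in> R - {i0} then s else sh i)) x" by simp
      moreover have "Wf i0 H (\<lambda>i. if i \<in> R - {i0} then s else sh i) = Wf i0 H (\<lambda>_. s)"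
        unfolding Wf_def by (intro ext) auto
      ultimately show ?thesis by simp
    qed
    have "pattern (R - {i0}) s (\<lambda>a. D a \<and> (\<forall>c\<in>C. a c = u c) \<and> a c0 = x) \<Phi>"
      unfolding pattern_def
    proof (intro exI[of _ "Wf i0 H (\<lambda>_. s)"] allI impI)
      fix \<eta> assume \<eta>: "\<forall>i\<in>R - {i0}. \<eta> i < s"
      \<comment> \<open>\<open>\<eta>\<close> is unconstrained at the dropped row, where 0 is a
        legal index because \<open>0 < s\<close>.\<close>
      define e0 where "e0 = restrict (\<eta>(i0 := 0)) R"
      have "e0 \<in> EE" using \<eta> s by (auto simp: e0_def EE_def)
      from fin[OF this] show "\<exists>a. (D a \<and> (\<forall>c\<in>C. a c = u c) \<and> a c0 = x) \<and>
          (\<forall>i\<in>R - {i0}. \<forall>j<s. \<Phi> i a (Wf i0 H (\<lambda>_. s) i j) \<longleftrightarrow> j = \<eta> i)"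
        unfolding \<Theta>_def by (auto simp: e0_def)
    qed
    then show ?thesis using i0 by blast
  qed
  show ?thesis by (intro exI[of _ N] allI impI main)
qed

end

text \<open>Predicates on total functions replace sets of extensional tuples, so that coordinates
  can be updated freely; this records that only the first \<open>k\<close> of them are read.\<close>

definition depends :: "nat \<Rightarrow> ((nat \<Rightarrow> 'a) \<Rightarrow> 'b) \<Rightarrow> bool" where
  "depends k D \<longleftrightarrow> (\<forall>a a'. (\<forall>i<k. a i = a' i) \<longrightarrow> D a = D a')"

lemma dependsD: "depends k D \<Longrightarrow> (\<And>i. i < k \<Longrightarrow> a i = a' i) \<Longrightarrow> D a = D a'"
  by (simp add: depends_def)

section \<open>From patterns to boxes\<close>

context C_minimal_monster
begin

text \<open>Induction on the number \<open>n\<close> of free coordinates besides \<open>i\<close>,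
  always with \<open>n + 1\<close> rows. Each fixed coordinate costs at most one row; when only
  coordinate \<open>i\<close> is free, a row of width \<open>m + 1\<close> needs as many points in a
  fibre that has at most \<open>m\<close>.\<close>

lemma no_pattern_if_finite_fibres:
  assumes D: "definable_pred M D" "depends k D" and i: "i < k"
    and fib: "\<And>a A. A \<subseteq> {y. D (a(i := y))} \<Longrightarrow> finite A \<and> card A \<le> m"
  shows "C \<subseteq> {..<k} - {i} \<Longrightarrow> card C + n = k - 1 \<Longrightarrow> finite R \<Longrightarrow> card R = Suc n \<Longrightarrow>
    (\<And>\<rho>. \<rho> \<in> R \<Longrightarrow> definable_pred M (\<lambda>e. \<Phi> \<rho> (\<lambda>n. e (Inl n)) (\<lambda>n. e (Inr n)))) \<Longrightarrow>
    (\<And>\<rho> w. \<rho> \<in> R \<Longrightarrow> depends k (\<lambda>a. \<Phi> \<rho> a w)) \<Longrightarrow>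
    \<exists>N. \<forall>u. \<not> pattern R N (\<lambda>a. D a \<and> (\<forall>c\<in>C. a c = u c)) \<Phi>"
proof (induction n arbitrary: C R)
  case 0
  have "C = {..<k} - {i}"
    using 0(1,2) i by (intro card_subset_eq) auto
  obtain \<rho> where R: "R = {\<rho>}" using 0(4) by (auto simp: card_Suc_eq)
  have "\<not> pattern R (Suc m) (\<lambda>a. D a \<and> (\<forall>c\<in>C. a c = u c)) \<Phi>" for u
  proof
    assume "pattern R (Suc m) (\<lambda>a. D a \<and> (\<forall>c\<in>C. a c = u c)) \<Phi>"
    then obtain b where b: "\<forall>\<eta>. (\<forall>i\<in>R. \<eta> i < Suc m) \<longrightarrow>
        (\<exists>a. (D a \<and> (\<forall>c\<in>C. a c = u c)) \<and> (\<forall>i\<in>R. \<forall>j<Suc m. \<Phi> i a (b i j) \<longleftrightarrow> j = \<eta> i))"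
      unfolding pattern_def ..
    have "\<exists>a. D a \<and> (\<forall>c\<in>C. a c = u c) \<and> (\<forall>j'\<le>m. \<Phi> \<rho> a (b \<rho> j') \<longleftrightarrow> j' = j)" if "j \<le> m" for j
      using b[THEN spec[of _ "\<lambda>_. j"]] that by (auto simp: R less_Suc_eq_le)
    then obtain a where a: "\<And>j. j \<le> m \<Longrightarrow> D (a j)" "\<And>j c. j \<le> m \<Longrightarrow> c \<in> C \<Longrightarrow> a j c = u c"
      "\<And>j j'. j \<le> m \<Longrightarrow> j' \<le> m \<Longrightarrow> \<Phi> \<rho> (a j) (b \<rho> j') \<longleftrightarrow> j' = j" by metis
    have "inj_on (\<lambda>j. a j i) {..m}"
    proof (rule inj_onI)
      fix j j' assume jj: "j \<in> {..m}" "j' \<in> {..m}" "a j i = a j' i"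
      have "a j l = a j' l" if "l < k" for l
        using jj a(2)[of j l] a(2)[of j' l] that \<open>C = _\<close> by (cases "l = i") auto
      then have "\<Phi> \<rho> (a j) (b \<rho> j) = \<Phi> \<rho> (a j') (b \<rho> j)"
        using dependsD[OF 0(6)[of \<rho>], of "a j" "a j'"] R by simp
      then show "j = j'" using a(3)[of j j] a(3)[of j' j] jj by auto
    qed
    then have "card ((\<lambda>j. a j i) ` {..m}) = Suc m" by (simp add: card_image)
    moreover have "(\<lambda>j. a j i) ` {..m} \<subseteq> {y. D (u(i := y))}"
    proof (intro image_subsetI CollectI)
      fix j assume j: "j \<in> {..m}"
      have "D (u(i := a j i)) = D (a j)"
        by (rule dependsD[OF D(2)]) (use a(2)[of j] j \<open>C = _\<close> in auto)
      then show "D (u(i := a j i))" using a(1) j by simp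
    qed
    ultimately show False using fib[of "(\<lambda>j. a j i) ` {..m}" u] by simp
  qed
  then show ?case by blast
next
  case (Suc n)
  have "card C < card ({..<k} - {i})" using Suc.prems(2) i by simp
  then have "C \<noteq> {..<k} - {i}" by auto
  then obtain c0 where c0: "c0 \<in> {..<k} - {i}" "c0 \<notin> C" using Suc.prems(1) by blast
  have fC: "finite C" using Suc.prems(1) finite_subset by blast
  \<comment> \<open>The row that gets lost is not known in advance, so the bound must serve every
    \<open>i0\<close> in \<open>R\<close>.\<close>
  define Q where "Q i0 N \<longleftrightarrow> (\<forall>u. \<not> pattern (R - {i0}) N (\<lambda>a. D a \<and> (\<forall>c\<in>insert c0 C. a c = u c)) \<Phi>)"
    for i0 N
  have "\<exists>N. Q i0 N" if "i0 \<in> R" for i0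
    unfolding Q_def
  proof (rule Suc.IH)
    show "card (insert c0 C) + n = k - 1" using c0 fC Suc.prems(2) by simp
  qed (use that c0 Suc.prems in \<open>auto simp: card_Diff_singleton\<close>)
  moreover have "Q i0 N'" if "Q i0 N" "N \<le> N'" for i0 N N'
    unfolding Q_def
  proof (intro allI notI)
    fix u assume "pattern (R - {i0}) N' (\<lambda>a. D a \<and> (\<forall>c\<in>insert c0 C. a c = u c)) \<Phi>"
    then have "pattern (R - {i0}) N (\<lambda>a. D a \<and> (\<forall>c\<in>insert c0 C. a c = u c)) \<Phi>"
      using that(2) by (rule pattern_mono)
    then show False using that(1) unfolding Q_def by blast
  qed
  ultimately obtain s where "\<forall>i0\<in>R. Q i0 s"
    using uniform_bound[OF Suc.prems(3), of Q] by blast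
  then have s: "\<not> pattern (R - {i0}) s (\<lambda>a. D a \<and> (\<forall>c\<in>insert c0 C. a c = u c)) \<Phi>" if "i0 \<in> R" for i0 u
    using that unfolding Q_def by blast
  have "R \<noteq> {}" using Suc.prems(4) by auto
  \<comment> \<open>The width is \<open>Suc s\<close> because a positive width is required.\<close>
  from pattern_fix_coordinate[OF D(1) Suc.prems(5,3) this fC zero_less_Suc, where ?c0.0 = c0]
  obtain N where N: "\<forall>u. pattern R N (\<lambda>a. D a \<and> (\<forall>c\<in>C. a c = u c)) \<Phi> \<longrightarrow>
    (\<exists>x. \<exists>i0\<in>R. pattern (R - {i0}) (Suc s) (\<lambda>a. D a \<and> (\<forall>c\<in>C. a c = u c) \<and> a c0 = x) \<Phi>)" ..
  have "\<not> pattern R N (\<lambda>a. D a \<and> (\<forall>c\<in>C. a c = u c)) \<Phi>" for u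
  proof
    assume "pattern R N (\<lambda>a. D a \<and> (\<forall>c\<in>C. a c = u c)) \<Phi>"
    with N obtain x i0 where i0: "i0 \<in> R"
      and x: "pattern (R - {i0}) (Suc s) (\<lambda>a. D a \<and> (\<forall>c\<in>C. a c = u c) \<and> a c0 = x) \<Phi>" by blast
    have "pattern (R - {i0}) s (\<lambda>a. D a \<and> (\<forall>c\<in>insert c0 C. a c = (u(c0 := x)) c)) \<Phi>"
      by (rule pattern_mono[OF x]) (use c0 in auto)
    then show False using s[OF i0] by blast
  qed
  then show ?case by blast
qed

text \<open>By saturation some \<open>c\<close> lies beyond the countably many bounds needed for the widths \<open>N\<close>.\<close>

lemma pattern_mono_union:
  assumes mono: "\<And>c c' a. v c \<le> v c' \<Longrightarrow> P c a \<Longrightarrow> P c' a"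
    and R: "finite R" and pattern: "\<And>N. pattern R N (\<lambda>a. \<exists>c. c \<noteq> 0 \<and> P c a) \<Phi>"
  shows "\<exists>c. c \<noteq> 0 \<and> (\<forall>N. pattern R N (P c) \<Phi>)"
proof -
  have "\<exists>c. c \<noteq> 0 \<and> pattern R N (P c) \<Phi>" for N
  proof -
    from pattern[of N] obtain b where b: "\<forall>\<eta>. (\<forall>i\<in>R. \<eta> i < N) \<longrightarrow>
        (\<exists>a. (\<exists>c. c \<noteq> 0 \<and> P c a) \<and> (\<forall>i\<in>R. \<forall>j<N. \<Phi> i a (b i j) \<longleftrightarrow> j = \<eta> i))"
      unfolding pattern_def ..
    \<comment> \<open>Restricted to \<open>R\<close> there are finitely many paths, so one
      \<open>d\<close> serves the whole pattern of width \<open>N\<close>.\<close>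
    let ?E = "R \<rightarrow>\<^sub>E {..<N}"
    have "\<exists>a c. c \<noteq> 0 \<and> P c a \<and> (\<forall>i\<in>R. \<forall>j<N. \<Phi> i a (b i j) \<longleftrightarrow> j = \<eta> i)" if "\<eta> \<in> ?E" for \<eta>
      using b[THEN spec[of _ \<eta>]] that by (auto simp: PiE_def Pi_def)
    then obtain a c where ac: "\<And>\<eta>. \<eta> \<in> ?E \<Longrightarrow> c \<eta> \<noteq> 0" "\<And>\<eta>. \<eta> \<in> ?E \<Longrightarrow> P (c \<eta>) (a \<eta>)"
      "\<And>\<eta>. \<eta> \<in> ?E \<Longrightarrow> \<forall>i\<in>R. \<forall>j<N. \<Phi> i (a \<eta>) (b i j) \<longleftrightarrow> j = \<eta> i" by metis
    have "finite (c ` ?E)" using R by (intro finite_imageI finite_PiE) auto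
    moreover have "0 \<notin> c ` ?E" using ac(1) by force
    ultimately obtain d where d: "d \<noteq> 0" "\<And>\<eta>. \<eta> \<in> ?E \<Longrightarrow> v (c \<eta>) \<le> v d"
      using ex_v_upper_bound[of "c ` ?E"] by blast
    have "pattern R N (P d) \<Phi>" unfolding pattern_def
    proof (intro exI[of _ b] allI impI)
      fix \<eta> assume "\<forall>i\<in>R. \<eta> i < N"
      then have E: "restrict \<eta> R \<in> ?E" by auto
      show "\<exists>a. P d a \<and> (\<forall>i\<in>R. \<forall>j<N. \<Phi> i a (b i j) \<longleftrightarrow> j = \<eta> i)"
        using mono[OF d(2)[OF E] ac(2)[OF E]] ac(3)[OF E] by auto
    qed
    then show ?thesis using d(1) by blast
  qed
  then obtain c where c: "\<And>N. c N \<noteq> 0" "\<And>N. pattern R N (P (c N)) \<Phi>" by metis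
  define F where "F N e \<longleftrightarrow> v (c N) \<le> v (e ()) \<and> e () \<noteq> 0" for N and e :: "unit \<Rightarrow> 'a"
  have F: "definable_pred M (F N)" for N unfolding F_def by (intro definable_pred_intros)
  have "\<exists>e. \<forall>m'\<le>m. F m' e" for m
  proof -
    have "finite (c ` {..m})" "0 \<notin> c ` {..m}" using c(1) by (auto simp: image_iff dest: sym)
    then obtain d where "d \<noteq> 0" "\<forall>s\<in>c ` {..m}. v s \<le> v d" using ex_v_upper_bound[of "c ` {..m}"] by blast
    then show ?thesis by (intro exI[of _ "\<lambda>_. d"]) (auto simp: F_def)
  qed
  from definable_pred_compactness[of \<kappa> M F "{()}", OF mm F _ _ this] obtain e where e: "\<forall>N. F N e"
    unfolding F_def by auto
  show ?thesis
  proof (intro exI[of _ "e ()"] conjI allI)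
    show "e () \<noteq> 0" using e by (simp add: F_def)
    show "pattern R N (P (e ())) \<Phi>" for N
      by (rule pattern_mono[OF c(2) order_refl mono]) (use e in \<open>auto simp: F_def\<close>)
  qed
qed

text \<open>The remaining points of \<open>D\<close> have boundedly many values in direction
  \<open>i\<close>, hence carry no wide pattern. Colour each path by whether an interior point
  realises it: a homogeneous subgrid must then be of the interior kind.\<close>

lemma pattern_interior_in_direction:
  assumes D: "definable_pred M D" "depends k D" and i: "i < k"
    and \<Phi>: "\<And>\<rho>. \<rho> < k \<Longrightarrow> definable_pred M (\<lambda>e. \<Phi> \<rho> (\<lambda>n. e (Inl n)) (\<lambda>n. e (Inr n)))"
      "\<And>\<rho> w. \<rho> < k \<Longrightarrow> depends k (\<lambda>a. \<Phi> \<rho> a w)"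
    and pattern: "\<And>N. pattern {..<k} N D \<Phi>"
  shows "\<exists>\<epsilon>. \<epsilon> \<noteq> 0 \<and> (\<forall>N. pattern {..<k} N (\<lambda>a. \<forall>y. v \<epsilon> < v (y - a i) \<longrightarrow> D (a(i := y))) \<Phi>)"
proof (rule pattern_mono_union)
  let ?I = "\<lambda>a. \<exists>\<epsilon>. \<epsilon> \<noteq> 0 \<and> (\<forall>y. v \<epsilon> < v (y - a i) \<longrightarrow> D (a(i := y)))"
  define X where "X a \<longleftrightarrow> D a \<and> \<not> ?I a" for a
  have dX: "definable_pred M X" unfolding X_def
    by (intro definable_pred_intros D(1) definable_pred_subst[OF D(1)]) auto
  have depX: "depends k X"
    unfolding depends_def
  proof (intro allI impI)
    fix a a' :: "nat \<Rightarrow> 'a" assume aa: "\<forall>i<k. a i = a' i"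
    have "D (a(i := y)) = D (a'(i := y))" for y
      by (rule dependsD[OF D(2)]) (use aa in auto)
    moreover have "D a = D a'" by (rule dependsD[OF D(2)]) (use aa in auto)
    ultimately show "X a = X a'" using aa i by (simp add: X_def)
  qed
  obtain m where m: "\<forall>e A. A \<subseteq> {x. D (e(i := x)) \<and>
    (\<nexists>\<epsilon>. \<epsilon> \<noteq> 0 \<and> (\<forall>y. v \<epsilon> < v (y - x) \<longrightarrow> D (e(i := y))))} \<longrightarrow> finite A \<and> card A \<le> m"
    using boundary_bound[OF D(1), of i] by blast
  have fibX: "finite A \<and> card A \<le> m" if "A \<subseteq> {y. X (a(i := y))}" for a A
    using m[THEN spec[of _ a], THEN spec[of _ A]] that by (simp add: X_def)
  have "\<exists>N. \<forall>u. \<not> pattern {..<k} N (\<lambda>a. X a \<and> (\<forall>c\<in>{}. a c = u c)) \<Phi>"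
    by (rule no_pattern_if_finite_fibres[OF dX depX i fibX, where n = "k - 1"]) (use \<Phi> i in auto)
  then obtain N1 where N1: "\<not> pattern {..<k} N1 X \<Phi>" by auto
  show "pattern {..<k} N ?I \<Phi>" for N
  proof -
    \<comment> \<open>Wide enough for the wanted pattern and for a contradiction on
      \<open>X\<close>.\<close>
    define n where "n = max N N1"
    obtain N' where N': "\<forall>Col :: (nat \<Rightarrow> nat) \<Rightarrow> bool. (\<forall>\<eta> \<eta>'. (\<forall>i<k. \<eta> i = \<eta>' i) \<longrightarrow> Col \<eta> = Col \<eta>') \<longrightarrow>
      (\<exists>g c. (\<forall>i<k. inj_on (g i) {..<n} \<and> g i ` {..<n} \<subseteq> {..<N'}) \<and>
        (\<forall>\<eta>. (\<forall>i<k. \<eta> i < n) \<longrightarrow> Col (\<lambda>i. g i (\<eta> i)) = c))"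
      using grid_ramsey[of k n] by blast
    from pattern[of N'] obtain b where b: "\<forall>\<eta>. (\<forall>i\<in>{..<k}. \<eta> i < N') \<longrightarrow>
        (\<exists>a. D a \<and> (\<forall>i\<in>{..<k}. \<forall>j<N'. \<Phi> i a (b i j) \<longleftrightarrow> j = \<eta> i))"
      unfolding pattern_def ..
    define Col where "Col \<eta> \<longleftrightarrow> (\<exists>a. ?I a \<and> (\<forall>i<k. \<forall>j<N'. \<Phi> i a (b i j) \<longleftrightarrow> j = \<eta> i))" for \<eta>
    have "\<forall>\<eta> \<eta>'. (\<forall>i<k. \<eta> i = \<eta>' i) \<longrightarrow> Col \<eta> = Col \<eta>'" by (simp add: Col_def)
    from N'[THEN spec, THEN mp, OF this] obtain g c
      where gc: "\<forall>i<k. inj_on (g i) {..<n} \<and> g i ` {..<n} \<subseteq> {..<N'}"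
        "\<forall>\<eta>. (\<forall>i<k. \<eta> i < n) \<longrightarrow> Col (\<lambda>i. g i (\<eta> i)) = c"
      by (elim exE conjE)
    have g: "inj_on (g i) {..<n}" "j < n \<Longrightarrow> g i j < N'" if "i < k" for i j
      using gc(1) that by auto
    have c: "Col (\<lambda>i. g i (\<eta> i)) = c" if "\<forall>i<k. \<eta> i < n" for \<eta>
      using gc(2) that by blast
    have sub: "pattern {..<k} n Y \<Phi>"
      if Y: "\<And>\<eta>. (\<forall>i<k. \<eta> i < n) \<Longrightarrow> \<exists>a. Y a \<and> (\<forall>i<k. \<forall>j<N'. \<Phi> i a (b i j) \<longleftrightarrow> j = g i (\<eta> i))" for Y
      unfolding pattern_def
    proof (intro exI[of _ "\<lambda>i j. b i (g i j)"] allI impI)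
      fix \<eta> assume \<eta>: "\<forall>i\<in>{..<k}. \<eta> i < n"
      then obtain a where a: "Y a" "\<forall>i<k. \<forall>j<N'. \<Phi> i a (b i j) \<longleftrightarrow> j = g i (\<eta> i)" using Y[of \<eta>] by auto
      have "\<Phi> i a (b i (g i j)) \<longleftrightarrow> j = \<eta> i" if "i < k" "j < n" for i j
        using a(2) g(2)[OF that] inj_on_eq_iff[OF g(1)[OF that(1)], of j "\<eta> i"] that \<eta> by simp
      then show "\<exists>a. Y a \<and> (\<forall>i\<in>{..<k}. \<forall>j<n. \<Phi> i a (b i (g i j)) \<longleftrightarrow> j = \<eta> i)" using a(1) by auto
    qed
    show ?thesis
    proof (cases c)
      case True
      then have "pattern {..<k} n ?I \<Phi>" using c by (intro sub) (simp add: Col_def)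
      then show ?thesis by (rule pattern_mono) (auto simp: n_def)
    next
      case False
      \<comment> \<open>No path of the subgrid has an interior realisation, so its realisations in
        \<open>D\<close> lie in \<open>X\<close>.\<close>
      have "pattern {..<k} n X \<Phi>"
      proof (rule sub)
        fix \<eta> assume \<eta>: "\<forall>i<k. \<eta> i < n"
        then obtain a where "D a" "\<forall>i<k. \<forall>j<N'. \<Phi> i a (b i j) \<longleftrightarrow> j = g i (\<eta> i)"
          using b[THEN spec[of _ "\<lambda>i. g i (\<eta> i)"]] g(2) by auto
        moreover have "\<not> Col (\<lambda>i. g i (\<eta> i))" using c[OF \<eta>] False by simp
        ultimately show "\<exists>a. X a \<and> (\<forall>i<k. \<forall>j<N'. \<Phi> i a (b i j) \<longleftrightarrow> j = g i (\<eta> i))"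
          unfolding Col_def X_def by blast
      qed
      then have "pattern {..<k} N1 X \<Phi>" by (rule pattern_mono) (auto simp: n_def)
      then show ?thesis using N1 by blast
    qed
  qed
qed (auto intro: le_less_trans)

text \<open>After \<open>j\<close> directions there remains a subset \<open>E\<close> with patterns
  of every width that is stable under small moves of the first \<open>j\<close> coordinates.
  Treating a new direction keeps this, since moves of different coordinates commute. In the end any
  point of \<open>E\<close> is the centre of a box.\<close>

lemma pattern_imp_box:
  assumes D: "definable_pred M D" "depends k D"
    and \<Phi>: "\<And>\<rho>. \<rho> < k \<Longrightarrow> definable_pred M (\<lambda>e. \<Phi> \<rho> (\<lambda>n. e (Inl n)) (\<lambda>n. e (Inr n)))"
      "\<And>\<rho> w. \<rho> < k \<Longrightarrow> depends k (\<lambda>a. \<Phi> \<rho> a w)"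
    and pattern: "\<And>N. pattern {..<k} N D \<Phi>"
  shows "\<exists>a \<epsilon>. \<epsilon> \<noteq> 0 \<and> (\<forall>a'. (\<forall>i<k. v \<epsilon> < v (a' i - a i)) \<longrightarrow> D a')"
proof -
  have "\<exists>E \<epsilon>. definable_pred M E \<and> depends k E \<and> (\<forall>a. E a \<longrightarrow> D a) \<and> (\<forall>N. pattern {..<k} N E \<Phi>) \<and> \<epsilon> \<noteq> 0 \<and>
      (\<forall>i<j. \<forall>a y. E a \<longrightarrow> v \<epsilon> < v (y - a i) \<longrightarrow> E (a(i := y)))" if "j \<le> k" for j
    using that
  proof (induction j)
    case 0
    show ?case by (rule exI[of _ D], rule exI[of _ 1]) (use D pattern in auto)
  next
    case (Suc j)
    then obtain E \<epsilon> where E: "definable_pred M E" "depends k E" "\<And>a. E a \<Longrightarrow> D a" "\<And>N. pattern {..<k} N E \<Phi>" "\<epsilon> \<noteq> 0"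
      "\<And>i a y. i < j \<Longrightarrow> E a \<Longrightarrow> v \<epsilon> < v (y - a i) \<Longrightarrow> E (a(i := y))"
      by (metis Suc_leD)
    have j: "j < k" using Suc.prems by simp
    from pattern_interior_in_direction[OF E(1,2) j \<Phi> E(4)] obtain \<delta> where \<delta>: "\<delta> \<noteq> 0"
      "\<And>N. pattern {..<k} N (\<lambda>a. \<forall>y. v \<delta> < v (y - a j) \<longrightarrow> E (a(j := y))) \<Phi>" by blast
    define E' where "E' a \<longleftrightarrow> (\<forall>y. v \<delta> < v (y - a j) \<longrightarrow> E (a(j := y)))" for a
    obtain \<epsilon>' where \<epsilon>': "\<epsilon>' \<noteq> 0" "v \<epsilon> \<le> v \<epsilon>'" "v \<delta> \<le> v \<epsilon>'"
      using ex_v_upper_bound[of "{\<epsilon>, \<delta>}"] E(5) \<delta>(1) by auto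
    show ?case
    proof (intro exI[of _ E'] exI[of _ \<epsilon>'] conjI allI impI \<epsilon>'(1))
      show "definable_pred M E'" unfolding E'_def
        by (intro definable_pred_intros definable_pred_subst[OF E(1)]) auto
      show "depends k E'" unfolding depends_def
      proof (intro allI impI)
        fix a a' :: "nat \<Rightarrow> 'a" assume aa: "\<forall>i<k. a i = a' i"
        have "E (a(j := y)) = E (a'(j := y))" for y
          by (rule dependsD[OF E(2)]) (use aa in auto)
        then show "E' a = E' a'" using aa j by (simp add: E'_def)
      qed
      show "pattern {..<k} N E' \<Phi>" for N using \<delta>(2) unfolding E'_def .
      show "D a" if "E' a" for a
      proof -
        have "E (a(j := a j))" 
          using that[unfolded E'_def, THEN spec[of _ "a j"]] v_less_Pinf_iff[of \<delta>] \<delta>(1) by simp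
        then show ?thesis using E(3) by simp
      qed
      fix i a y assume i: "i < Suc j" and a: "E' a" and y: "v \<epsilon>' < v (y - a i)"
      have y': "v \<epsilon> < v (y - a i)" "v \<delta> < v (y - a i)" using y \<epsilon>'(2,3) by order+
      show "E' (a(i := y))" unfolding E'_def
      proof (intro allI impI)
        fix z assume z: "v \<delta> < v (z - (a(i := y)) j)"
        show "E (a(i := y, j := z))"
        proof (cases "i = j")
          case True
          \<comment> \<open>Every point of an ultrametric ball is its centre, so moves in direction
            \<open>j\<close> itself compose.\<close>
          then have "v \<delta> < v (z - a j)" using v_diff_gt_trans[of "v \<delta>" z y "a j"] z y'(2) by simp
          then show ?thesis using a True unfolding E'_def by simp
        next
          case False
          then have "E (a(j := z))" using a z unfolding E'_def by simp
          then have "E ((a(j := z))(i := y))" using E(6)[of i "a(j := z)" y] i False y'(1) by simp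
          then show ?thesis using False by (simp add: fun_upd_twist)
        qed
      qed
    qed
  qed
  from this[of k] obtain E \<epsilon> where E: "depends k E" "\<And>a. E a \<Longrightarrow> D a" "pattern {..<k} 1 E \<Phi>" "\<epsilon> \<noteq> 0"
      "\<And>i a y. i < k \<Longrightarrow> E a \<Longrightarrow> v \<epsilon> < v (y - a i) \<Longrightarrow> E (a(i := y))" by auto
  \<comment> \<open>Width 1 serves only to show that \<open>E\<close> is nonempty.\<close>
  from E(3) obtain b :: "nat \<Rightarrow> nat \<Rightarrow> nat \<Rightarrow> 'a" where "\<forall>\<eta>. (\<forall>i\<in>{..<k}. \<eta> i < 1) \<longrightarrow>
      (\<exists>a. E a \<and> (\<forall>i\<in>{..<k}. \<forall>j<1. \<Phi> i a (b i j) \<longleftrightarrow> j = \<eta> i))"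
    unfolding pattern_def ..
  from this[THEN spec[of _ "\<lambda>_. 0"]] obtain a where a: "E a" by auto
  have "D a'" if a': "\<forall>i<k. v \<epsilon> < v (a' i - a i)" for a'
  proof -
    have "E (\<lambda>i. if i < j then a' i else a i)" if "j \<le> k" for j
      using that
    proof (induction j)
      case 0
      show ?case using a by simp
    next
      case (Suc j)
      have "(\<lambda>i. if i < Suc j then a' i else a i) = (\<lambda>i. if i < j then a' i else a i)(j := a' j)"
        by (auto simp: less_Suc_eq)
      then show ?case using Suc E(5)[of j "\<lambda>i. if i < j then a' i else a i" "a' j"] a' by simp
    qed
    from this[of k] have "E a'" using dependsD[OF E(1), of "\<lambda>i. if i < k then a' i else a i" a'] by simp
    then show ?thesis by (rule E(2))
  qed
  then show ?thesis using E(4) by blast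
qed

end

section \<open>Generic continuity\<close>

context C_minimal_monster
begin

section \<open>Limits and continuity in terms of balls\<close>

lemma openin_valuation_topology_imp_ball:
  assumes "openin (valuation_topology v) T" "x \<in> T"
  shows "\<exists>c. c \<noteq> 0 \<and> (\<forall>y. v c < v (y - x) \<longrightarrow> y \<in> T)"
proof -
  have "generate_topology_on {open_ball v c \<gamma> | c \<gamma>. True} T"
    using assms(1) by (simp add: valuation_topology_def openin_topology_generated_by_iff)
  then have "x \<in> T \<longrightarrow> (\<exists>c. c \<noteq> 0 \<and> (\<forall>y. v c < v (y - x) \<longrightarrow> y \<in> T))" for x
  proof (induction arbitrary: x)
    case Empty
    then show ?case by simp
  next
    case (Int S T)
    show ?case
    proof
      assume "x \<in> S \<inter> T"
      then obtain c d where c: "c \<noteq> 0" "\<forall>y. v c < v (y - x) \<longrightarrow> y \<in> S"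
        and d: "d \<noteq> 0" "\<forall>y. v d < v (y - x) \<longrightarrow> y \<in> T"
        using Int.IH[of x] by auto
      obtain e where "e \<noteq> 0" "v c \<le> v e" "v d \<le> v e"
        using ex_v_upper_bound[of "{c, d}"] c(1) d(1) by auto
      then show "\<exists>c. c \<noteq> 0 \<and> (\<forall>y. v c < v (y - x) \<longrightarrow> y \<in> S \<inter> T)"
        using c(2) d(2) by (meson IntI le_less_trans)
    qed
  next
    case (UN K)
    then show ?case by (meson UnionE UnionI)
  next
    case (Basis S)
    then obtain c \<gamma> where S: "S = open_ball v c \<gamma>" by auto
    obtain r where r: "r \<noteq> 0" "v r = Fin \<gamma>" using ex_v_Fin by blast
    show ?case unfolding S open_ball_def mem_Collect_eq
      using r v_diff_gt_trans[of "Fin \<gamma>" _ x c] by (metis (no_types, lifting))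
  qed
  then show ?thesis using assms(2) by blast
qed

lemma openin_open_ball:
  assumes "c \<noteq> 0" shows "openin (valuation_topology v) {y. v c < v (y - x)}"
proof -
  obtain \<gamma> where "v c = Fin \<gamma>" using v_ex_Fin assms by blast
  then have "{y. v c < v (y - x)} \<in> {open_ball v c \<gamma> | c \<gamma>. True}" by (auto simp: open_ball_def)
  then show ?thesis
    unfolding valuation_topology_def by (rule topology_generated_by_Basis)
qed

lemma topspace_valuation_topology: "topspace (valuation_topology v) = UNIV"
proof -
  have "x \<in> topspace (valuation_topology v)" for x
    using openin_subset[OF openin_open_ball[of 1 x]] v_less_Pinf_iff[of 1] by auto
  then show ?thesis by blast
qed

text \<open>The limit is punctured; at \<open>y = 0\<close> the difference vanishes and has value
  \<open>Pinf\<close>.\<close>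

lemma limitin_imp_ball:
  assumes "limitin (valuation_topology v) h (h 0) (atin_within (valuation_topology v) 0 B)" "c \<noteq> 0"
  shows "\<exists>\<delta>. \<delta> \<noteq> 0 \<and> (\<forall>y\<in>B. v \<delta> < v y \<longrightarrow> v c < v (h y - h 0))"
proof -
  have "h 0 \<in> {y. v c < v (y - h 0)}" using assms(2) by (simp add: v_less_Pinf_iff)
  then have "\<forall>\<^sub>F y in atin_within (valuation_topology v) 0 B. v c < v (h y - h 0)"
    using assms(1)[unfolded limitin_def, THEN conjunct2, THEN spec, THEN mp,
        OF conjI[OF openin_open_ball[OF assms(2), of "h 0"]]] by simp
  then obtain T where T: "openin (valuation_topology v) T" "0 \<in> T"
    "\<And>y. y \<in> T \<Longrightarrow> y \<in> B \<Longrightarrow> y \<noteq> 0 \<Longrightarrow> v c < v (h y - h 0)"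
    by (auto simp: eventually_atin_within topspace_valuation_topology)
  obtain \<delta> where \<delta>: "\<delta> \<noteq> 0" "\<And>y. v \<delta> < v y \<Longrightarrow> y \<in> T"
    using openin_valuation_topology_imp_ball[OF T(1,2)] by auto
  show ?thesis
  proof (intro exI[of _ \<delta>] conjI \<delta>(1) ballI impI)
    fix y assume "y \<in> B" "v \<delta> < v y"
    then show "v c < v (h y - h 0)"
      using T(3) \<delta>(2) assms(2) by (cases "y = 0") (auto simp: v_less_Pinf_iff)
  qed
qed

lemma topcontinuous_atI:
  assumes a: "a \<in> U" "U \<subseteq> tuples k" "0 \<in> B"
    and cont: "\<And>c. c \<noteq> 0 \<Longrightarrow> \<exists>\<delta>. \<delta> \<noteq> 0 \<and> (\<forall>a'\<in>U. \<forall>y\<in>B. (\<forall>i<k. v \<delta> < v (a' i - a i)) \<longrightarrow> v \<delta> < v y \<longrightarrow>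
      v c < v (f (a', y) - f (a, 0)))"
  shows "topcontinuous_at
     (subtopology (prod_topology (power_topology v k) (valuation_topology v)) (U \<times> B))
     (valuation_topology v) f (a, 0)"
  unfolding topcontinuous_at_def
proof (intro conjI allI impI)
  show "(a, 0) \<in> topspace (subtopology (prod_topology (power_topology v k) (valuation_topology v)) (U \<times> B))"
    using a by (auto simp: topspace_valuation_topology)
  show "f \<in> topspace (subtopology (prod_topology (power_topology v k) (valuation_topology v)) (U \<times> B)) \<rightarrow>
      topspace (valuation_topology v)"
    by (simp add: topspace_valuation_topology)
  fix V assume V: "openin (valuation_topology v) V \<and> f (a, 0) \<in> V"
  then obtain c where c: "c \<noteq> 0" "\<And>y. v c < v (y - f (a, 0)) \<Longrightarrow> y \<in> V"
    using openin_valuation_topology_imp_ball by blast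
  obtain \<delta> where \<delta>: "\<delta> \<noteq> 0" "\<And>a' y. a' \<in> U \<Longrightarrow> y \<in> B \<Longrightarrow> \<forall>i<k. v \<delta> < v (a' i - a i) \<Longrightarrow> v \<delta> < v y \<Longrightarrow>
      v c < v (f (a', y) - f (a, 0))"
    using cont[OF c(1)] by blast
  let ?W = "(PiE {..<k} (\<lambda>i. {y. v \<delta> < v (y - a i)})) \<times> {y. v \<delta> < v (y - 0)}"
  have "openin (prod_topology (power_topology v k) (valuation_topology v)) ?W"
    unfolding openin_prod_Times_iff
    by (intro disjI2 conjI openin_open_ball \<delta>(1)) (simp add: openin_PiE openin_open_ball \<delta>(1))
  then have "openin (subtopology (prod_topology (power_topology v k) (valuation_topology v)) (U \<times> B)) (?W \<inter> (U \<times> B))"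
    by (auto simp: openin_subtopology)
  moreover have "(a, 0) \<in> ?W \<inter> (U \<times> B)"
    using a \<delta>(1) by (auto simp: v_less_Pinf_iff)
  moreover have "\<forall>z\<in>?W \<inter> (U \<times> B). f z \<in> V"
    using c(2) \<delta>(2) by (auto simp: PiE_def Pi_def)
  ultimately show "\<exists>W. openin (subtopology (prod_topology (power_topology v k) (valuation_topology v)) (U \<times> B)) W \<and>
      (a, 0) \<in> W \<and> (\<forall>z\<in>W. f z \<in> V)" by blast
qed

end

lemma dp_rank_ge_imp_ict_pattern_in:
  assumes "\<not> dp_rank M k X < ereal (real k)"
  shows "\<exists>n\<ge>k. ict_pattern_in M k X n"
proof (rule ccontr)
  assume "\<not> ?thesis"
  then have *: "n < k" if "ict_pattern_in M k X n" for n using that not_le by blast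
  show False
  proof (cases k)
    case 0
    then have "{n. ict_pattern_in M k X n} = {}" using * by auto
    then have "dp_rank M k X = - \<infinity>" by (simp add: dp_rank_def bot_ereal_def)
    then show False using assms by simp
  next
    case (Suc l)
    have "dp_rank M k X \<le> ereal (real l)"
      unfolding dp_rank_def using * Suc by (intro SUP_least) (simp add: less_Suc_eq_le)
    then show False using assms Suc by (metis ereal_less_eq(3) le_less_trans less_ereal.simps(1) lessI of_nat_less_iff)
  qed
qed

theorem theorem9p3:
  fixes M :: "('f, 'r, 'a::alg_closed_field) fo_structure"
    and \<kappa> :: "'c rel"
    and v :: "'a \<Rightarrow> 'g::linordered_ab_group_add extended"
    and t :: 'f
    and k :: nat
    and U :: "(nat \<Rightarrow> 'a) set"
    and B :: "'a set"
    and f :: "(nat \<Rightarrow> 'a) \<times> 'a \<Rightarrow> 'a"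
  assumes "monster_model \<kappa> M"
    and "ACVF_expansion M v"
    and "C_minimal M v"
    and "fun_arity M t = 0" and "0 < v (fun_int M t [])"
    and "is_ball v B" and "0 \<in> B"
    and "definable M k U" and "openin (power_topology v k) U"
    and "definable_fun M k U B f"
    and "\<And>a. a \<in> U \<Longrightarrow>
           limitin (valuation_topology v) (\<lambda>y. f (a, y)) (f (a, 0))
             (atin_within (valuation_topology v) 0 B)"
  shows "dp_rank M k
           {a \<in> U. \<not> topcontinuous_at
              (subtopology (prod_topology (power_topology v k) (valuation_topology v)) (U \<times> B))
              (valuation_topology v) f (a, 0)}
         < ereal (real k)"
proof (rule ccontr)
  interpret C_minimal_monster M \<kappa> v by unfold_locales fact+
  assume "\<not> ?thesis"
  from dp_rank_ge_imp_ict_pattern_in[OF this] obtain n where n: "k \<le> n"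
    and ict: "ict_pattern_in M k {a \<in> U. \<not> topcontinuous_at
              (subtopology (prod_topology (power_topology v k) (valuation_topology v)) (U \<times> B))
              (valuation_topology v) f (a, 0)} n" by blast
  have U: "U \<subseteq> tuples k" using \<open>definable M k U\<close> unfolding definable_def by auto
  define gr where "gr a y w \<longleftrightarrow> restrict a {..<k} \<in> U \<and> y \<in> B \<and> w = f (restrict a {..<k}, y)"
    for a :: "nat \<Rightarrow> 'a" and y w
  have dep_gr: "gr a y w = gr a' y w" if "\<And>i. i < k \<Longrightarrow> a i = a' i" for a a' y w
  proof -
    have "restrict a {..<k} = restrict a' {..<k}" using that by auto
    then show ?thesis by (simp add: gr_def)
  qed
  have gr0: "restrict a {..<k} \<in> U \<Longrightarrow> gr a 0 (f (restrict a {..<k}, 0))" for a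
    using \<open>0 \<in> B\<close> by (simp add: gr_def)
  have GR: "definable_pred M (\<lambda>e. gr e (e k) (e (k + 1)))"
  proof -
    have "restrict (restrict e {..<k + 2}) {..<k} = restrict e {..<k}" for e :: "nat \<Rightarrow> 'a"
      by auto
    then have "restrict e {..<k + 2} \<in> {e \<in> tuples (k + 2). restrict e {..<k} \<in> U \<and> e k \<in> B \<and>
        e (k + 1) = f (restrict e {..<k}, e k)} \<longleftrightarrow> gr e (e k) (e (k + 1))" for e :: "nat \<Rightarrow> 'a"
      by (auto simp: gr_def)
    then show ?thesis
      using definable_imp_definable_pred[OF \<open>definable_fun M k U B f\<close>[unfolded definable_fun_def]] by simp
  qed
  have definable_pred_gr: "definable_pred M (\<lambda>e :: 'i \<Rightarrow> 'a. gr (\<tau> e) (\<sigma> e) (\<rho> e))"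
    if "\<And>i. (\<exists>j. \<forall>e. \<tau> e i = e j) \<or> (\<exists>c. \<forall>e. \<tau> e i = c)"
      "(\<exists>j. \<forall>e. \<sigma> e = e j) \<or> (\<exists>c. \<forall>e. \<sigma> e = c)" "(\<exists>j. \<forall>e. \<rho> e = e j) \<or> (\<exists>c. \<forall>e. \<rho> e = c)"
    for \<tau> \<sigma> \<rho>
  proof -
    define \<tau>' where "\<tau>' e n = (if n < k then \<tau> e n else if n = k then \<sigma> e else \<rho> e)" for e n
    have "gr (\<tau> e) (\<sigma> e) (\<rho> e) \<longleftrightarrow> gr (\<tau>' e) (\<tau>' e k) (\<tau>' e (k + 1))" for e
      using dep_gr[of "\<tau> e" "\<tau>' e"] by (simp add: \<tau>'_def)
    moreover have "definable_pred M (\<lambda>e. gr (\<tau>' e) (\<tau>' e k) (\<tau>' e (k + 1)))"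
    proof (rule definable_pred_subst[OF GR])
      fix i
      consider "i < k" | "i = k" | "i > k" by linarith
      then show "(\<exists>j. \<forall>e. \<tau>' e i = e j) \<or> (\<exists>c. \<forall>e. \<tau>' e i = c)"
        by cases (use that in \<open>simp_all add: \<tau>'_def\<close>)
    qed
    ultimately show ?thesis by simp
  qed
  define Disc where "Disc c a \<longleftrightarrow> (\<exists>w0. gr a 0 w0 \<and> (\<forall>\<delta>. \<delta> \<noteq> 0 \<longrightarrow> (\<exists>a' y w. gr a' y w \<and>
      (\<forall>i<k. v \<delta> < v (a' i - a i)) \<and> v \<delta> < v y \<and> \<not> v c < v (w - w0))))" for c a
  define Lim where "Lim c \<delta> a \<longleftrightarrow> Disc c a \<and> (\<forall>y w w0. gr a y w \<longrightarrow> gr a 0 w0 \<longrightarrow> v \<delta> < v y \<longrightarrow> v c < v (w - w0))"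
    for c \<delta> a
  have dDisc: "definable_pred M (\<lambda>e :: 'i \<Rightarrow> 'a. Disc c (\<lambda>n. e (h n)))" for c and h :: "nat \<Rightarrow> 'i"
    unfolding Disc_def by (intro definable_pred_intros definable_pred_gr) auto
  have dep_Disc: "depends k (Disc c)" for c
    unfolding depends_def
  proof (intro allI impI)
    fix a a' :: "nat \<Rightarrow> 'a" assume aa: "\<forall>i<k. a i = a' i"
    have "gr a 0 w \<longleftrightarrow> gr a' 0 w" for w by (rule dep_gr) (use aa in auto)
    then show "Disc c a = Disc c a'" using aa by (simp add: Disc_def)
  qed
  have dep_Lim: "depends k (Lim c \<delta>)" for c \<delta>
    unfolding depends_def
  proof (intro allI impI)
    fix a a' :: "nat \<Rightarrow> 'a" assume aa: "\<forall>i<k. a i = a' i"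
    have "gr a y w \<longleftrightarrow> gr a' y w" for y w by (rule dep_gr) (use aa in auto)
    moreover have "Disc c a = Disc c a'" by (rule dependsD[OF dep_Disc]) (use aa in auto)
    ultimately show "Lim c \<delta> a = Lim c \<delta> a'" by (simp add: Lim_def)
  qed
  obtain \<phi> :: "nat \<Rightarrow> ('f, 'r) fo_formula" and b where \<phi>: "\<And>i. i < n \<Longrightarrow> wf_formula M (\<phi> i)"
    and b: "\<And>\<eta> :: nat \<Rightarrow> nat. \<exists>a \<in> {a \<in> U. \<not> topcontinuous_at
              (subtopology (prod_topology (power_topology v k) (valuation_topology v)) (U \<times> B))
              (valuation_topology v) f (a, 0)}.
        \<forall>i<n. \<forall>j. sat M (tuple_env k a (b i j)) (\<phi> i) \<longleftrightarrow> j = \<eta> i"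
    using ict unfolding ict_pattern_in_def by auto
  define \<Phi> where "\<Phi> i a w = sat M (tuple_env k a w) (\<phi> i)" for i a w
  have d\<Phi>: "definable_pred M (\<lambda>e. \<Phi> i (\<lambda>n. e (Inl n)) (\<lambda>n. e (Inr n)))" if "i < k" for i
  proof -
    have "tuple_env k (\<lambda>n. e (Inl n)) (\<lambda>n. e (Inr n)) =
        assignment (\<lambda>m. if m < k then Inl (Inl m) else Inl (Inr m)) e" for e :: "nat + nat \<Rightarrow> 'a"
      by (auto simp: tuple_env_def assignment_def)
    then show ?thesis using \<phi>[of i] that n unfolding definable_pred_def \<Phi>_def by auto
  qed
  have dep\<Phi>: "\<Phi> i a w = \<Phi> i a' w" if "\<And>i. i < k \<Longrightarrow> a i = a' i" for i a a' w
  proof -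
    have "tuple_env k a w = tuple_env k a' w" using that by (auto simp: tuple_env_def)
    then show ?thesis by (simp add: \<Phi>_def)
  qed
  have "pattern {..<k} N (\<lambda>a. \<exists>c. c \<noteq> 0 \<and> Disc c a) \<Phi>" for N
    unfolding pattern_def
  proof (intro exI[of _ b] allI impI)
    fix \<eta> :: "nat \<Rightarrow> nat"
    obtain a where a: "a \<in> U" "\<not> topcontinuous_at
              (subtopology (prod_topology (power_topology v k) (valuation_topology v)) (U \<times> B))
              (valuation_topology v) f (a, 0)"
      "\<forall>i<n. \<forall>j. sat M (tuple_env k a (b i j)) (\<phi> i) \<longleftrightarrow> j = \<eta> i"
      using b[of \<eta>] by blast
    have res: "restrict a {..<k} = a" if "a \<in> U" for a using that U by (auto simp: PiE_def extensional_restrict)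
    obtain c where c: "c \<noteq> 0" "\<And>\<delta>. \<delta> \<noteq> 0 \<Longrightarrow> \<exists>a'\<in>U. \<exists>y\<in>B. (\<forall>i<k. v \<delta> < v (a' i - a i)) \<and> v \<delta> < v y \<and>
        \<not> v c < v (f (a', y) - f (a, 0))"
      using topcontinuous_atI[OF a(1) U \<open>0 \<in> B\<close>, of f] a(2) by blast
    have "Disc c a" unfolding Disc_def
    proof (intro exI[of _ "f (a, 0)"] conjI allI impI)
      show "gr a 0 (f (a, 0))" using gr0[of a] a(1) by (simp add: res)
      fix \<delta> :: 'a assume "\<delta> \<noteq> 0"
      from c(2)[OF this] obtain a' y where "a' \<in> U" "y \<in> B" "\<forall>i<k. v \<delta> < v (a' i - a i)" "v \<delta> < v y"
        "\<not> v c < v (f (a', y) - f (a, 0))" by blast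
      then show "\<exists>a' y w. gr a' y w \<and> (\<forall>i<k. v \<delta> < v (a' i - a i)) \<and> v \<delta> < v y \<and> \<not> v c < v (w - f (a, 0))"
        by (intro exI[of _ a'] exI[of _ y] exI[of _ "f (a', y)"]) (simp add: gr_def res)
    qed
    then show "\<exists>a. (\<exists>c. c \<noteq> 0 \<and> Disc c a) \<and> (\<forall>i\<in>{..<k}. \<forall>j<N. \<Phi> i a (b i j) \<longleftrightarrow> j = \<eta> i)"
      using c(1) a(3) n by (intro exI[of _ a]) (auto simp: \<Phi>_def)
  qed
  moreover have "Disc c' a" if "v c \<le> v c'" "Disc c a" for c c' a
    using that unfolding Disc_def by (meson le_less_trans)
  ultimately obtain c where c: "c \<noteq> 0" "\<And>N. pattern {..<k} N (Disc c) \<Phi>"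
    using pattern_mono_union[of Disc "{..<k}" \<Phi>] by blast
  have ex_Lim: "\<exists>\<delta>. \<delta> \<noteq> 0 \<and> Lim c \<delta> a" if "Disc c a" for a
  proof -
    let ?a = "restrict a {..<k}"
    have aU: "?a \<in> U" using that by (auto simp: Disc_def gr_def)
    obtain \<delta> where "\<delta> \<noteq> 0" "\<And>y. y \<in> B \<Longrightarrow> v \<delta> < v y \<Longrightarrow> v c < v (f (?a, y) - f (?a, 0))"
      using limitin_imp_ball[of "\<lambda>y. f (?a, y)" B c] assms(11)[OF aU] c(1) by blast
    then show ?thesis using that by (intro exI[of _ \<delta>]) (auto simp: Lim_def gr_def)
  qed
  have "pattern {..<k} N (\<lambda>a. \<exists>\<delta>. \<delta> \<noteq> 0 \<and> Lim c \<delta> a) \<Phi>" for N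
    by (rule pattern_mono[OF c(2) order_refl]) (rule ex_Lim)
  moreover have "Lim c \<delta>' a" if "v \<delta> \<le> v \<delta>'" "Lim c \<delta> a" for \<delta> \<delta>' a
    using that unfolding Lim_def by (meson le_less_trans)
  ultimately obtain \<delta>0 where \<delta>0: "\<delta>0 \<noteq> 0" "\<And>N. pattern {..<k} N (Lim c \<delta>0) \<Phi>"
    using pattern_mono_union[of "Lim c" "{..<k}" \<Phi>] by blast
  obtain t :: "nat \<Rightarrow> 'a" where t: "inj t" "range t \<subseteq> {x. v c < v x}"
    using infinite_countable_subset[OF infinite_v_gt[OF c(1)]] by blast
  define D where "D a \<longleftrightarrow> Lim c \<delta>0 a \<and> (\<exists>w0. gr a 0 w0 \<and> v c < v (a k - w0))" for a
  define \<Psi> where "\<Psi> i a w \<longleftrightarrow> (if i < k then \<Phi> i a w else (\<exists>w0. gr a 0 w0 \<and> a k = w0 + w (0::nat)))" for i a w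
  have dD: "definable_pred M D" unfolding D_def Lim_def
    by (intro definable_pred_intros definable_pred_gr dDisc) auto
  have depD: "depends (Suc k) D" unfolding depends_def
  proof (intro allI impI)
    fix a a' :: "nat \<Rightarrow> 'a" assume aa: "\<forall>i<Suc k. a i = a' i"
    have "gr a 0 w \<longleftrightarrow> gr a' 0 w" for w by (rule dep_gr) (use aa in auto)
    moreover have "Lim c \<delta>0 a = Lim c \<delta>0 a'" by (rule dependsD[OF dep_Lim]) (use aa in auto)
    ultimately show "D a = D a'" using aa by (simp add: D_def)
  qed
  have d\<Psi>: "definable_pred M (\<lambda>e. \<Psi> i (\<lambda>n. e (Inl n)) (\<lambda>n. e (Inr n)))" if "i < Suc k" for i
  proof (cases "i < k")
    case True
    then show ?thesis using d\<Phi> by (simp add: \<Psi>_def)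
  next
    case False
    have "definable_pred M (\<lambda>e. \<exists>w0. gr (\<lambda>n. e (Inl n)) 0 w0 \<and> e (Inl k) = w0 + e (Inr (0::nat)))"
      by (intro definable_pred_intros definable_pred_gr) auto
    then show ?thesis using False by (simp add: \<Psi>_def)
  qed
  have dep\<Psi>: "depends (Suc k) (\<lambda>a. \<Psi> i a w)" for i w
    unfolding depends_def
  proof (intro allI impI)
    fix a a' :: "nat \<Rightarrow> 'a" assume aa: "\<forall>i<Suc k. a i = a' i"
    have "gr a 0 w \<longleftrightarrow> gr a' 0 w" for w by (rule dep_gr) (use aa in auto)
    moreover have "\<Phi> i a w = \<Phi> i a' w" by (rule dep\<Phi>) (use aa in auto)
    ultimately show "\<Psi> i a w = \<Psi> i a' w" using aa by (simp add: \<Psi>_def)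
  qed
  have "pattern {..<Suc k} N D \<Psi>" for N
  proof -
    from \<delta>0(2)[of N] obtain b where b: "\<forall>\<eta>. (\<forall>i\<in>{..<k}. \<eta> i < N) \<longrightarrow>
        (\<exists>a. Lim c \<delta>0 a \<and> (\<forall>i\<in>{..<k}. \<forall>j<N. \<Phi> i a (b i j) \<longleftrightarrow> j = \<eta> i))"
      unfolding pattern_def ..
    show ?thesis unfolding pattern_def
    proof (intro exI[of _ "\<lambda>i j. if i < k then b i j else (\<lambda>_. t j)"] allI impI)
      fix \<eta> assume "\<forall>i\<in>{..<Suc k}. \<eta> i < N"
      then obtain a where a: "Lim c \<delta>0 a" "\<forall>i\<in>{..<k}. \<forall>j<N. \<Phi> i a (b i j) \<longleftrightarrow> j = \<eta> i"
        using b[THEN spec[of _ \<eta>]] by auto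
      obtain w0 where w0: "gr a 0 w0" using a(1) by (auto simp: Lim_def Disc_def)
      let ?a = "a(k := w0 + t (\<eta> k))"
      have gra: "gr ?a 0 w \<longleftrightarrow> w = w0" for w
        using dep_gr[of ?a a 0 w] w0 by (auto simp: gr_def)
      have "Lim c \<delta>0 ?a" using dependsD[OF dep_Lim, of a ?a] a(1) by simp
      moreover have "v c < v (t (\<eta> k))" using t(2) by auto
      ultimately have "D ?a" by (simp add: D_def gra)
      moreover have "\<Phi> i ?a w = \<Phi> i a w" for i w by (rule dep\<Phi>) simp
      moreover have "\<Psi> k ?a (\<lambda>_. t j) \<longleftrightarrow> j = \<eta> k" for j
        using injD[OF t(1), of j "\<eta> k"] by (auto simp: \<Psi>_def gra)
      ultimately show "\<exists>a. D a \<and> (\<forall>i\<in>{..<Suc k}. \<forall>j<N. \<Psi> i a (if i < k then b i j else (\<lambda>_. t j)) \<longleftrightarrow> j = \<eta> i)"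
        using a(2) by (intro exI[of _ ?a]) (auto simp: less_Suc_eq \<Psi>_def)
    qed
  qed
  from pattern_imp_box[OF dD depD d\<Psi> dep\<Psi> this] obtain a \<epsilon> where \<epsilon>: "\<epsilon> \<noteq> 0"
    and box: "\<And>a'. \<forall>i<Suc k. v \<epsilon> < v (a' i - a i) \<Longrightarrow> D a'" by blast
  obtain \<delta> where \<delta>: "\<delta> \<noteq> 0" "v \<epsilon> \<le> v \<delta>" "v \<delta>0 \<le> v \<delta>"
    using ex_v_upper_bound[of "{\<epsilon>, \<delta>0}"] \<epsilon> \<delta>0(1) by auto
  have "D a" using box[of a] \<epsilon> by (simp add: v_less_Pinf_iff)
  then obtain w0 where w0: "gr a 0 w0" "v c < v (a k - w0)" "Disc c a" by (auto simp: D_def Lim_def)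
  then obtain a' y w where w: "gr a' y w" "\<forall>i<k. v \<delta> < v (a' i - a i)" "v \<delta> < v y" "\<not> v c < v (w - w0)"
    using \<delta>(1) unfolding Disc_def gr_def by blast
  let ?a = "\<lambda>i. if i < k then a' i else a i"
  have "D ?a"
    by (rule box) (use w(2) \<delta>(2) \<epsilon> in \<open>auto simp: v_less_Pinf_iff intro: le_less_trans\<close>)
  then obtain w1 where w1: "gr ?a 0 w1" "v c < v (a k - w1)" "Lim c \<delta>0 ?a" by (auto simp: D_def)
  have "gr ?a y w" using dep_gr[of ?a a' y w] w(1) by simp
  then have "v c < v (w - w1)"
    using w1(1,3) w(3) \<delta>(3) unfolding Lim_def by (meson le_less_trans)
  moreover have "v c < v (w1 - a k)" using w1(2) by (simp add: v_diff_commute)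
  ultimately have "v c < v (w - w0)"
    using w0(2) v_diff_gt_trans by blast
  then show False using w(4) by blast
qed

end
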